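(* Assume that $\nu(\mathbb R_0)<\infty$. Let $x\in\mathbb R$, let $f:\mathbb R\to\mathbb R$ be a monotone function with bounded derivative, and let $h\in L^2(\mathbb R_0,\nu)$ with $h(y)\ne0$ for $y\in\mathbb R_0$. Let $Z$ be the solution of $$Z_t=x+\int_0^tf(Z_s)\,ds+\int_{[0,t]\times\mathbb R_0}h(y)\,dN(s,y),\qquad t\in[0,T].$$ Then $Z_T$ is absolutely continuous on the set $\{N^{\mathbb R_0}_T\ge1\}$, where $N^{\mathbb R_0}_T=N([0,T]\times\mathbb R_0)$; that is, $\mathbb P(\{Z_T\in B\}\cap\{N^{\mathbb R_0}_T\ge1\})=0$ for every Borel set $B\subset\mathbb R$ of zero Lebesgue measure.
   Context: Fix $T>0$ and $\mathbb R_0=\mathbb R\setminus\{0\}$. $N$ is the jump measure on $(0,\infty)\times\mathbb R_0$ of a real Lévy process $X$ with Lévy measure $\nu$ on a complete probability space $(\Omega,\mathcal F,\mathbb P)$, i.e. $N(B)=\#\{t>0:(t,\Delta X_t)\in B\}$; it is a Poisson random measure with intensity $dt\,\nu(dx)$.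
   Formalization: "Monotone" is taken as strictly monotone (increasing or decreasing); for weakly monotone f the claim is false, e.g. f = 0, h = 1 gives Z_T = x + N_T, which is discrete on the set where there is at least one jump. *)

theory Defs
  imports "HOL-Probability.Probability"
begin

text \<open>The sets \<open>S\<close> below are \<open>{0..}\<close> and \<open>{0..T}\<close>. At an end point of \<open>S\<close> the one-sided
  condition pointing out of \<open>S\<close> is void, since the filter is then \<open>bot\<close>.\<close>

definition cadlag_on :: "real set \<Rightarrow> (real \<Rightarrow> real) \<Rightarrow> bool" where
  "cadlag_on S x \<longleftrightarrow>
     (\<forall>t\<in>S. continuous (at t within (S \<inter> {t..})) x \<and>
            (\<exists>l. (x \<longlongrightarrow> l) (at t within (S \<inter> {..<t}))))"

text \<open>Time is \<open>{0..}\<close>; values \<open>X t\<close> at \<open>t < 0\<close> are irrelevant. Stochastic continuity is not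
  listed because it follows from stationarity of the increments and right-continuity at 0.\<close>

locale levy_process = prob_space M for M :: "'a measure" +
  fixes X :: "real \<Rightarrow> 'a \<Rightarrow> real"
  assumes random_variable_X: "\<And>t. 0 \<le> t \<Longrightarrow> X t \<in> borel_measurable M"
    and start_zero: "AE \<omega> in M. X 0 \<omega> = 0"
    and independent_increments:
      "\<And>t :: nat \<Rightarrow> real. \<lbrakk>mono t; 0 \<le> t 0\<rbrakk> \<Longrightarrow>
         indep_vars (\<lambda>_. borel) (\<lambda>i \<omega>. X (t (Suc i)) \<omega> - X (t i) \<omega>) (UNIV :: nat set)"
    and stationary_increments:
      "\<And>s u. \<lbrakk>0 \<le> s; 0 \<le> u\<rbrakk> \<Longrightarrow>
         distr M borel (\<lambda>\<omega>. X (s + u) \<omega> - X s \<omega>) = distr M borel (\<lambda>\<omega>. X u \<omega> - X 0 \<omega>)"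
    and cadlag_paths: "AE \<omega> in M. cadlag_on {0..} (\<lambda>t. X t \<omega>)"

definition jump :: "(real \<Rightarrow> real) \<Rightarrow> real \<Rightarrow> real" where
  "jump x t = x t - Lim (at_left t) x"

text \<open>The jump measure of a path lives on \<open>(0,\<infinity>) \<times> (\<real> - {0})\<close>. It is extended by zero to the
  Borel sets of the plane, so that sets such as \<open>{0..T} \<times> (-{0})\<close> are measurable for it.\<close>

definition jump_measure :: "(real \<Rightarrow> real) \<Rightarrow> (real \<times> real) measure" where
  "jump_measure x = distr (count_space {t. 0 < t \<and> jump x t \<noteq> 0}) borel (\<lambda>t. (t, jump x t))"

lemma sets_jump_measure [simp]: "sets (jump_measure x) = sets borel"
  by (simp add: jump_measure_def)

lemma emeasure_jump_measure:
  assumes "B \<in> sets borel"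
  shows "emeasure (jump_measure x) B =
    (let J = {t. 0 < t \<and> jump x t \<noteq> 0 \<and> (t, jump x t) \<in> B}
     in if finite J then of_nat (card J) else \<infinity>)"
proof -
  let ?S = "{t. 0 < t \<and> jump x t \<noteq> 0}"
  have "emeasure (jump_measure x) B = emeasure (count_space ?S) ((\<lambda>t. (t, jump x t)) -` B \<inter> ?S)"
    using assms by (simp add: jump_measure_def emeasure_distr)
  also have "(\<lambda>t. (t, jump x t)) -` B \<inter> ?S = {t. 0 < t \<and> jump x t \<noteq> 0 \<and> (t, jump x t) \<in> B}"
    by auto
  finally show ?thesis
    by (simp add: Let_def emeasure_count_space subset_eq)
qed

text \<open>Poisson random measure with intensity \<open>\<mu>\<close>. The Poisson weights are written out because
  \<^const>\<open>poisson_pmf\<close> is meaningful only for a positive rate. Independence over finite disjoint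
  families is the case of eventually empty sequences.\<close>

definition poisson_random_measure ::
    "'a measure \<Rightarrow> ('a \<Rightarrow> 'b measure) \<Rightarrow> 'b measure \<Rightarrow> bool" where
  "poisson_random_measure M N \<mu> \<longleftrightarrow>
     (\<forall>\<omega>\<in>space M. sets (N \<omega>) = sets \<mu>) \<and>
     (\<forall>A\<in>sets \<mu>. (\<lambda>\<omega>. emeasure (N \<omega>) A) \<in> borel_measurable M) \<and>
     (\<forall>A\<in>sets \<mu>. emeasure \<mu> A < \<infinity> \<longrightarrow>
        (\<forall>n::nat. measure M {\<omega>\<in>space M. emeasure (N \<omega>) A = of_nat n} =
                    measure \<mu> A ^ n / fact n * exp (- measure \<mu> A))) \<and>
     (\<forall>A\<in>sets \<mu>. emeasure \<mu> A = \<infinity> \<longrightarrow> (AE \<omega> in M. emeasure (N \<omega>) A = \<infinity>)) \<and>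
     (\<forall>A :: nat \<Rightarrow> 'b set. range A \<subseteq> sets \<mu> \<longrightarrow> disjoint_family A \<longrightarrow>
        prob_space.indep_vars M (\<lambda>_. borel) (\<lambda>i \<omega>. emeasure (N \<omega>) (A i)) UNIV)"

text \<open>The L\'evy measure of \<open>X\<close>: a measure on \<open>\<real> - {0}\<close>, extended by zero to the Borel sets of
  the line, whose value at \<open>B\<close> is the expected number of jumps in \<open>B\<close> per unit of time.\<close>

definition levy_measure ::
    "'a measure \<Rightarrow> (real \<Rightarrow> 'a \<Rightarrow> real) \<Rightarrow> real measure \<Rightarrow> bool" where
  "levy_measure M X \<nu> \<longleftrightarrow>
     sets \<nu> = sets borel \<and>
     (\<forall>B\<in>sets borel. emeasure \<nu> B =
        (\<integral>\<^sup>+ \<omega>. emeasure (jump_measure (\<lambda>t. X t \<omega>)) ({0<..1} \<times> B) \<partial>M))"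

text \<open>\<open>dt \<nu>(dx)\<close> on \<open>(0,\<infinity>) \<times> \<real>\<close>, extended by zero.\<close>

definition time_intensity :: "real measure \<Rightarrow> (real \<times> real) measure" where
  "time_intensity \<nu> = density lborel (indicator {0<..}) \<Otimes>\<^sub>M \<nu>"

text \<open>Solution on \<open>[0,T]\<close>, up to indistinguishability. Cadlag paths guarantee that the Lebesgue
  integral of \<open>f(Z\<^sub>s)\<close> exists, and the integral against \<open>N\<close> is pathwise.\<close>

definition jump_sde_solution ::
    "'a measure \<Rightarrow> ('a \<Rightarrow> (real \<times> real) measure) \<Rightarrow> real \<Rightarrow> real \<Rightarrow> (real \<Rightarrow> real) \<Rightarrow>
     (real \<Rightarrow> real) \<Rightarrow> (real \<Rightarrow> 'a \<Rightarrow> real) \<Rightarrow> bool" where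
  "jump_sde_solution M N T x f h Z \<longleftrightarrow>
     (\<forall>t\<in>{0..T}. Z t \<in> borel_measurable M) \<and>
     (AE \<omega> in M. cadlag_on {0..T} (\<lambda>t. Z t \<omega>)) \<and>
     (AE \<omega> in M. \<forall>t\<in>{0..T}.
        Z t \<omega> = x + (LINT s:{0..t}|lborel. f (Z s \<omega>))
                  + (LINT p:{0..t} \<times> (-{0})|N \<omega>. h (snd p)))"

end

theory Submission
  imports Defs
begin

text \<open>Condition on the last jump. If \<open>(a,T]\<close> contains exactly one jump, at time \<open>s\<close> with mark \<open>y\<close>, then
  \<open>Z\<^sub>T = \<phi> (T - s) (\<phi> (s - a) Z\<^sub>a + h y)\<close>, where \<open>\<phi>\<close> is the flow of \<open>u' = f u\<close>. For fixed \<open>Z\<^sub>a\<close> and \<open>y\<close> the jump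
  time \<open>s\<close> is a Lipschitz function of the right-hand side, because \<open>f\<close> is injective and \<open>h y \<noteq> 0\<close>; so
  only a null set of jump times is mapped into a given null set. Now \<open>Z\<^sub>a\<close> is independent of the
  jumps after \<open>a\<close>, being the limit of an Euler scheme driven by the jumps up to \<open>a\<close>, and on this event the
  law of \<open>(s, y)\<close> is a multiple of \<open>dt \<nu>(dx)\<close>, so Fubini applies. Since there are finitely many
  jumps, countably many rational \<open>a\<close> cover the event that there is a jump at all.\<close>

section \<open>The flow of an autonomous equation\<close>

text \<open>The notion of solution carries no filtration and no adaptedness: \<open>Z t\<close> is
  merely measurable, and the equation holds almost surely. Independence of \<open>Z a\<close> from
  later jumps therefore has to be extracted from the equation. The Euler scheme does this because it
  reads only finitely many counts of \<open>N\<close>, on products of a time cell with a level set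
  of a simple function close to \<open>h\<close>; independence of counts on disjoint sets is exactly
  what a Poisson random measure provides. The cut \<open>a\<close> is deterministic because that
  independence says nothing directly about random times. With a single jump left after
  \<open>a\<close>, the joint law of several jump times never enters. Strict monotonicity matters:
  for constant \<open>f\<close> the jump times have no influence on \<open>Z T\<close>, which may
  then have atoms.\<close>

lemma exp_weighted_integral_bound:
  fixes w :: "real \<Rightarrow> real"
  assumes K: "0 < K" and s: "0 \<le> s" and C: "0 \<le> C"
    and w: "continuous_on {0..s} w" and bd: "\<And>r. r \<in> {0..s} \<Longrightarrow> \<bar>w r\<bar> \<le> C * exp (K * r)"
  shows "\<bar>exp (- (K * s)) * integral {0..s} w\<bar> \<le> C / K"
proof -
  have "((\<lambda>r. C * exp (K * r)) has_integral (C * exp (K * s) / K - C * exp (K * 0) / K)) {0..s}"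
    by (rule fundamental_theorem_of_calculus[OF s])
      (use K in \<open>auto intro!: derivative_eq_intros simp flip: has_real_derivative_iff_has_vector_derivative\<close>)
  then have E: "((\<lambda>r. C * exp (K * r)) has_integral (C * exp (K * s) / K - C / K)) {0..s}"
    by simp
  have "norm (integral {0..s} w) \<le> integral {0..s} (\<lambda>r. C * exp (K * r))"
    by (rule integral_norm_bound_integral)
      (use w bd E in \<open>auto intro: integrable_continuous_real simp: has_integral_iff\<close>)
  also have "\<dots> \<le> C * exp (K * s) / K"
    unfolding integral_unique[OF E] using K C by simp
  finally have "exp (- (K * s)) * \<bar>integral {0..s} w\<bar> \<le> exp (- (K * s)) * (C * exp (K * s) / K)"
    by (intro mult_left_mono) auto
  also have "\<dots> = C / K"
    by (simp add: exp_minus field_simps)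
  finally show ?thesis
    by (simp add: abs_mult)
qed

text \<open>Picard iteration contracts on all of \<open>[0,\<infinity>)\<close> at once when the deviation from the initial
  value is weighted by \<open>exp (- K t)\<close> with \<open>K > L\<close>, so no continuation argument is needed.\<close>

lemma lipschitz_ode_exists:
  fixes f :: "real \<Rightarrow> real"
  assumes lip: "L-lipschitz_on UNIV f"
  shows "\<exists>u. u 0 = z \<and> (\<forall>t\<ge>0. (u has_real_derivative f (u t)) (at t within {0..}))"
proof -
  \<comment> \<open>The contraction factor comes out as \<open>L / K\<close>, which this choice
    keeps below \<open>1/2\<close>; the summand 1 keeps \<open>K\<close> positive when
    \<open>L = 0\<close>.\<close>
  define K where "K = 2 * (L + 1)"
  have L: "0 \<le> L" using lip by (rule lipschitz_on_nonneg)
  then have K: "0 < K" by (simp add: K_def)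
  have fL: "\<bar>f a - f b\<bar> \<le> L * \<bar>a - b\<bar>" for a b
    using lipschitz_onD[OF lip] by (auto simp: dist_real_def)
  have fc: "continuous_on S f" for S
    using lipschitz_on_continuous_on[OF lip] by (rule continuous_on_subset) auto
  \<comment> \<open>The unknown is \<open>g t = exp (- (K * t)) * (u t - z)\<close>, which stays
    bounded even where \<open>u\<close> grows exponentially.\<close>
  define w where "w g r = f (z + exp (K * r) * apply_bcontfun g r)" for g and r :: real
  have wc: "continuous_on S (w g)" for S g
    unfolding w_def by (rule continuous_on_compose2[OF fc[of UNIV]]) (auto intro!: continuous_intros)
  \<comment> \<open>The clamp \<open>max 0 t\<close> makes \<open>P g\<close> vanish at negative
    times; it is there because the complete space of bounded continuous functions is taken over the
    whole line.\<close>
  define P where "P g t = exp (- (K * max 0 t)) * integral {0..max 0 t} (w g)" for g t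
  have Pin: "P g \<in> bcontfun" for g
  proof -
    obtain B where "0 < B" and B: "\<forall>y\<in>range (apply_bcontfun g). norm y \<le> B"
      using bounded_apply_bcontfun[of g] unfolding bounded_pos by blast
    then have B: "0 \<le> B" "\<And>r. \<bar>apply_bcontfun g r\<bar> \<le> B"
      by auto
    define C where "C = \<bar>f z\<bar> + L * B"
    have C: "0 \<le> C" using B L by (simp add: C_def)
    have wb: "\<bar>w g r\<bar> \<le> C * exp (K * r)" if "0 \<le> r" for r
    proof -
      have e: "1 \<le> exp (K * r)" using K that by simp
      have "\<bar>w g r\<bar> \<le> \<bar>f z\<bar> + L * \<bar>exp (K * r) * apply_bcontfun g r\<bar>"
        using fL[of "z + exp (K * r) * apply_bcontfun g r" z] by (simp add: w_def)
      also have "\<dots> \<le> \<bar>f z\<bar> * exp (K * r) + L * (exp (K * r) * B)"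
        using B L e by (intro add_mono mult_left_mono) (auto simp: abs_mult mult_le_cancel_left1)
      finally show ?thesis by (simp add: C_def algebra_simps)
    qed
    have bd: "\<bar>P g t\<bar> \<le> C / K" for t
      unfolding P_def by (rule exp_weighted_integral_bound[OF K _ C wc]) (auto intro: wb)
    have "continuous_on {0..b} (\<lambda>s. integral {0..s} (w g))" for b
      by (intro indefinite_integral_continuous_1 integrable_continuous_real wc)
    then have "continuous_on {0..} (\<lambda>s. integral {0..s} (w g))"
      unfolding continuous_on_eq_continuous_within
    proof safe
      fix s :: real assume c: "\<And>b. \<forall>s\<in>{0..b}. continuous (at s within {0..b}) (\<lambda>s. integral {0..s} (w g))" and s: "0 \<le> s"
      have "continuous (at s within {0..s+1}) (\<lambda>s. integral {0..s} (w g))"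
        using c[of "s+1"] s by auto
      moreover have "at s within {0..s+1} = at s within {0..}"
        by (rule at_within_nhd[of _ "{..<s+1}"]) auto
      ultimately show "continuous (at s within {0..}) (\<lambda>s. integral {0..s} (w g))" by simp
    qed
    then have "continuous_on UNIV (\<lambda>t. integral {0..max 0 t} (w g))"
      by (rule continuous_on_compose2) (auto intro!: continuous_intros)
    then have "continuous_on UNIV (P g)"
      unfolding P_def by (intro continuous_intros) auto
    with bd show ?thesis
      by (auto simp: bcontfun_def bounded_iff intro!: exI[of _ "C / K"])
  qed
  define Q where "Q g = Bcontfun (P g)" for g
  have Q: "apply_bcontfun (Q g) = P g" for g
    unfolding Q_def using Pin by (rule Bcontfun_inverse)
  have "dist (Q g1) (Q g2) \<le> (1/2) * dist g1 g2" for g1 g2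
  proof (rule dist_bound)
    fix t :: real
    define s where "s = max 0 t"
    have i: "w g integrable_on {0..s}" for g and s :: real by (intro integrable_continuous_real wc)
    have b: "\<bar>w g1 r - w g2 r\<bar> \<le> (L * dist g1 g2) * exp (K * r)" for r
    proof -
      have "\<bar>w g1 r - w g2 r\<bar> \<le> L * \<bar>exp (K * r) * (apply_bcontfun g1 r - apply_bcontfun g2 r)\<bar>"
        using fL[of "z + exp (K * r) * apply_bcontfun g1 r" "z + exp (K * r) * apply_bcontfun g2 r"]
        by (simp add: w_def algebra_simps)
      also have "\<dots> \<le> L * (exp (K * r) * dist g1 g2)"
        using dist_bounded[of g1 r g2] L by (intro mult_left_mono) (auto simp: abs_mult dist_real_def)
      finally show ?thesis by (simp add: mult_ac)
    qed
    have "dist (apply_bcontfun (Q g1) t) (apply_bcontfun (Q g2) t) =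
      \<bar>exp (- (K * s)) * integral {0..s} (\<lambda>r. w g1 r - w g2 r)\<bar>"
      using i by (simp add: Q P_def dist_real_def s_def integral_diff algebra_simps)
    also have "\<dots> \<le> L * dist g1 g2 / K"
      using L by (intro exp_weighted_integral_bound K b continuous_intros wc) (auto simp: s_def)
    also have "\<dots> \<le> 1/2 * dist g1 g2"
      using L by (simp add: K_def field_simps)
    finally show "dist (apply_bcontfun (Q g1) t) (apply_bcontfun (Q g2) t) \<le> 1/2 * dist g1 g2" .
  qed
  then obtain g where g: "Q g = g"
    using banach_fix_type[of "1/2" Q] by auto
  define u where "u t = z + integral {0..t} (w g)" for t
  have u: "u t = z + exp (K * t) * apply_bcontfun g t" if "0 \<le> t" for t
  proof -
    have "apply_bcontfun g t = P g t" using Q[of g] g by simp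
    with that show ?thesis by (simp add: P_def u_def exp_minus)
  qed
  have "(u has_real_derivative f (u t)) (at t within {0..})" if t: "0 \<le> t" for t
  proof -
    have "((\<lambda>t. integral {0..t} (w g)) has_real_derivative w g t) (at t within {0..t+1})"
      using t by (intro integral_has_real_derivative wc) auto
    moreover have "at t within {0..t+1} = at t within {0..}"
      by (rule at_within_nhd[of _ "{..<t+1}"]) auto
    ultimately show ?thesis
      using u[OF t] unfolding u_def w_def by (auto intro!: derivative_eq_intros)
  qed
  moreover have "u 0 = z" by (simp add: u_def)
  ultimately show ?thesis by blast
qed

section \<open>Gronwall estimates and the flow\<close>

text \<open>Gronwall in both directions: since \<open>(u - v) * (f u - f v)\<close> is at most
  \<open>L * (u - v)\<^sup>2\<close> in absolute value, the squared distance increases when weighted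
  by \<open>exp (2 * L * t)\<close> and decreases when weighted by \<open>exp (- 2 * L * t)\<close>.
  Squares avoid differentiating an absolute value at zero. The lower bound later keeps distinct
  states apart.\<close>

lemma ode_solutions_bounds:
  fixes f u v :: "real \<Rightarrow> real"
  assumes lip: "L-lipschitz_on UNIV f" and b: "0 \<le> b"
    and u: "\<And>t. t \<in> {0..b} \<Longrightarrow> (u has_real_derivative f (u t)) (at t within {0..b})"
    and v: "\<And>t. t \<in> {0..b} \<Longrightarrow> (v has_real_derivative f (v t)) (at t within {0..b})"
  shows "\<bar>u b - v b\<bar> \<le> exp (L * b) * \<bar>u 0 - v 0\<bar>"
    and "exp (- (L * b)) * \<bar>u 0 - v 0\<bar> \<le> \<bar>u b - v b\<bar>"
proof -
  have fL: "\<bar>f a - f b\<bar> \<le> L * \<bar>a - b\<bar>" for a b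
    using lipschitz_onD[OF lip] by (auto simp: dist_real_def)
  have key: "\<bar>(a - c) * (f a - f c)\<bar> \<le> L * (a - c)\<^sup>2" for a c
  proof -
    have "\<bar>a - c\<bar> * \<bar>f a - f c\<bar> \<le> \<bar>a - c\<bar> * (L * \<bar>a - c\<bar>)"
      by (intro mult_left_mono fL) simp
    also have "\<dots> = L * \<bar>a - c\<bar>\<^sup>2" by (simp only: power2_eq_square mult_ac)
    finally show ?thesis by (simp only: abs_mult power2_abs)
  qed
  have cu: "continuous_on {0..b} u" and cv: "continuous_on {0..b} v"
    using u v by (meson DERIV_continuous_on)+
  have D: "((\<lambda>t. (u t - v t)\<^sup>2 * exp (c * t)) has_real_derivative
      (2 * ((u t - v t) * (f (u t) - f (v t))) + c * (u t - v t)\<^sup>2) * exp (c * t)) (at t)"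
    if "0 < t" "t < b" for t c
  proof -
    have at: "at t within {0..b} = at t" using that by (simp add: at_within_Icc_at)
    have "t \<in> {0..b}" using that by auto
    from u[OF this] v[OF this] show ?thesis
      unfolding at by (auto intro!: derivative_eq_intros simp: algebra_simps power2_eq_square)
  qed
  have "(u 0 - v 0)\<^sup>2 * exp (2 * L * 0) \<le> (u b - v b)\<^sup>2 * exp (2 * L * b)"
    using b
  proof (rule DERIV_nonneg_imp_increasing_open)
    fix t assume t: "0 < t" "t < b"
    have "0 \<le> 2 * ((u t - v t) * (f (u t) - f (v t))) + 2 * L * (u t - v t)\<^sup>2"
      using key[of "u t" "v t"] by linarith
    then show "\<exists>y. ((\<lambda>t. (u t - v t)\<^sup>2 * exp (2 * L * t)) has_real_derivative y) (at t) \<and> 0 \<le> y"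
      using D[OF t, of "2 * L"] by (blast intro: mult_nonneg_nonneg exp_ge_zero)
  qed (intro continuous_intros cu cv)
  then have "(exp (- (L * b)) * \<bar>u 0 - v 0\<bar>)\<^sup>2 \<le> \<bar>u b - v b\<bar>\<^sup>2"
    by (simp add: power_mult_distrib exp_minus field_simps flip: exp_double)
  then show "exp (- (L * b)) * \<bar>u 0 - v 0\<bar> \<le> \<bar>u b - v b\<bar>"
    by (rule power2_le_imp_le) simp
  have "(u b - v b)\<^sup>2 * exp (- 2 * L * b) \<le> (u 0 - v 0)\<^sup>2 * exp (- 2 * L * 0)"
    using b
  proof (rule DERIV_nonpos_imp_decreasing_open)
    fix t assume t: "0 < t" "t < b"
    have "2 * ((u t - v t) * (f (u t) - f (v t))) + - 2 * L * (u t - v t)\<^sup>2 \<le> 0"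
      using key[of "u t" "v t"] by linarith
    then show "\<exists>y. ((\<lambda>t. (u t - v t)\<^sup>2 * exp (- 2 * L * t)) has_real_derivative y) (at t) \<and> y \<le> 0"
      using D[OF t, of "- 2 * L"] by (blast intro: mult_nonpos_nonneg exp_ge_zero)
  qed (intro continuous_intros cu cv)
  then have "\<bar>u b - v b\<bar>\<^sup>2 \<le> (exp (L * b) * \<bar>u 0 - v 0\<bar>)\<^sup>2"
    by (simp add: power_mult_distrib exp_minus field_simps flip: exp_double)
  then show "\<bar>u b - v b\<bar> \<le> exp (L * b) * \<bar>u 0 - v 0\<bar>"
    by (rule power2_le_imp_le) simp
qed

text \<open>Only forward time occurs, so nothing is asserted about \<open>\<phi> t\<close> for
  \<open>t < 0\<close>; the lower Gronwall bound does the work of an inverse flow.\<close>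

locale lipschitz_flow =
  fixes f :: "real \<Rightarrow> real" and L :: real and \<phi> :: "real \<Rightarrow> real \<Rightarrow> real"
  assumes lip: "L-lipschitz_on UNIV f"
    and flow_0: "\<And>z. \<phi> 0 z = z"
    and flow_deriv: "\<And>z t. 0 \<le> t \<Longrightarrow> ((\<lambda>t. \<phi> t z) has_real_derivative f (\<phi> t z)) (at t within {0..})"
begin

lemma lip_nonneg: "0 \<le> L"
  using lip by (rule lipschitz_on_nonneg)

lemma lip_bound: "\<bar>f a - f b\<bar> \<le> L * \<bar>a - b\<bar>"
  using lipschitz_onD[OF lip] by (auto simp: dist_real_def)

lemma continuous_on_rhs: "continuous_on S f"
  using lipschitz_on_continuous_on[OF lip] by (rule continuous_on_subset) auto

lemma flow_deriv_Icc:
  "t \<in> {0..b} \<Longrightarrow> ((\<lambda>t. \<phi> t z) has_real_derivative f (\<phi> t z)) (at t within {0..b})"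
  by (rule has_field_derivative_subset[OF flow_deriv]) auto

lemma flow_upper: "0 \<le> b \<Longrightarrow> \<bar>\<phi> b z - \<phi> b w\<bar> \<le> exp (L * b) * \<bar>z - w\<bar>"
  using ode_solutions_bounds(1)[OF lip _ flow_deriv_Icc flow_deriv_Icc, of b z w] by (simp add: flow_0)

lemma flow_lower: "0 \<le> b \<Longrightarrow> exp (- (L * b)) * \<bar>z - w\<bar> \<le> \<bar>\<phi> b z - \<phi> b w\<bar>"
  using ode_solutions_bounds(2)[OF lip _ flow_deriv_Icc flow_deriv_Icc, of b z w] by (simp add: flow_0)

lemma flow_unique:
  assumes "0 \<le> b" and "\<And>t. t \<in> {0..b} \<Longrightarrow> (u has_real_derivative f (u t)) (at t within {0..b})"
  shows "u b = \<phi> b (u 0)"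
  using ode_solutions_bounds(1)[OF lip assms flow_deriv_Icc, of "u 0"] by (simp add: flow_0)

lemma flow_add:
  assumes "0 \<le> s" "0 \<le> t"
  shows "\<phi> (s + t) z = \<phi> t (\<phi> s z)"
proof -
  have "\<phi> (s + t) z = \<phi> t (\<phi> (s + 0) z)"
  proof (rule flow_unique[OF \<open>0 \<le> t\<close>])
    fix r assume r: "r \<in> {0..t}"
    have "((\<lambda>t. \<phi> t z) has_real_derivative f (\<phi> (s + r) z)) (at (s + r) within (+) s ` {0..t})"
      using assms r by (intro has_field_derivative_subset[OF flow_deriv]) auto
    moreover have "((+) s has_real_derivative 1) (at r within {0..t})"
      by (auto intro!: derivative_eq_intros)
    ultimately show "((\<lambda>t. \<phi> (s + t) z) has_real_derivative f (\<phi> (s + r) z)) (at r within {0..t})"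
      using DERIV_image_chain by (fastforce simp: o_def)
  qed
  then show ?thesis by simp
qed

text \<open>Continuity in time at a fixed state, combined with the Lipschitz bound in the state,
  whose constant \<open>exp (L * t)\<close> is locally bounded in time.\<close>

lemma continuous_on_flow: "continuous_on ({0..} \<times> UNIV) (\<lambda>(t, z). \<phi> t z)"
  unfolding continuous_on_def
proof (intro ballI)
  fix q :: "real \<times> real" assume q: "q \<in> {0..} \<times> UNIV"
  obtain s w where sw: "q = (s, w)" by (cases q)
  with q have s: "s \<in> {0..}" by auto
  let ?F = "at (s, w) within ({0..} \<times> UNIV)"
  have fst: "((\<lambda>p. fst p) \<longlongrightarrow> s) ?F" and snd: "((\<lambda>p. snd p) \<longlongrightarrow> w) ?F"
    by (auto intro!: tendsto_eq_intros)
  have ev: "\<forall>\<^sub>F p in ?F. p \<in> {0..} \<times> UNIV"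
    by (simp add: eventually_at_filter)
  have "continuous_on {0..} (\<lambda>t. \<phi> t w)"
    using flow_deriv by (intro DERIV_continuous_on) auto
  then have "((\<lambda>p. \<phi> (fst p) w) \<longlongrightarrow> \<phi> s w) ?F"
    by (rule continuous_on_tendsto_compose[OF _ fst s]) (use ev in \<open>auto elim: eventually_mono\<close>)
  then have "((\<lambda>p. exp (L * fst p) * \<bar>snd p - w\<bar> + \<bar>\<phi> (fst p) w - \<phi> s w\<bar>)
      \<longlongrightarrow> exp (L * s) * \<bar>w - w\<bar> + \<bar>\<phi> s w - \<phi> s w\<bar>) ?F"
    by (intro tendsto_intros fst snd)
  then have lim: "((\<lambda>p. exp (L * fst p) * \<bar>snd p - w\<bar> + \<bar>\<phi> (fst p) w - \<phi> s w\<bar>) \<longlongrightarrow> 0) ?F"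
    by simp
  have "\<forall>\<^sub>F p in ?F. norm ((case p of (t, z) \<Rightarrow> \<phi> t z) - \<phi> s w)
      \<le> exp (L * fst p) * \<bar>snd p - w\<bar> + \<bar>\<phi> (fst p) w - \<phi> s w\<bar>"
    using ev
  proof (rule eventually_mono)
    fix p :: "real \<times> real" assume "p \<in> {0..} \<times> UNIV"
    then have "\<bar>\<phi> (fst p) (snd p) - \<phi> (fst p) w\<bar> \<le> exp (L * fst p) * \<bar>snd p - w\<bar>"
      by (intro flow_upper) auto
    then show "norm ((case p of (t, z) \<Rightarrow> \<phi> t z) - \<phi> s w)
        \<le> exp (L * fst p) * \<bar>snd p - w\<bar> + \<bar>\<phi> (fst p) w - \<phi> s w\<bar>"
      by (auto simp: split_beta)
  qed
  then have "((\<lambda>p. (case p of (t, z) \<Rightarrow> \<phi> t z) - \<phi> s w) \<longlongrightarrow> 0) ?F"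
    using lim by (rule Lim_null_comparison)
  then have "((\<lambda>(t, z). \<phi> t z) \<longlongrightarrow> \<phi> s w) ?F"
    by (rule LIM_zero_cancel)
  then show "((\<lambda>(t, z). \<phi> t z) \<longlongrightarrow> (case q of (t, z) \<Rightarrow> \<phi> t z)) (at q within {0..} \<times> UNIV)"
    by (simp add: sw)
qed

lemma continuous_on_flow' [continuous_intros]:
  assumes "continuous_on S g" "continuous_on S k" "\<And>x. x \<in> S \<Longrightarrow> 0 \<le> g x"
  shows "continuous_on S (\<lambda>x. \<phi> (g x) (k x))"
  using continuous_on_compose2[OF continuous_on_flow, of S "\<lambda>x. (g x, k x)"] assms
  by (auto intro: continuous_intros)

text \<open>Moving the jump time from \<open>s\<close> to \<open>s' = s + \<delta>\<close> replaces \<open>\<phi> \<delta> (w + k)\<close> by \<open>\<phi> \<delta> w + k\<close>, where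
  \<open>w\<close> is the state before the jump. These differ by a multiple of \<open>\<delta>\<close> bounded below, because
  \<open>f\<close> is injective. Hence the final state determines the jump time in a Lipschitz way.\<close>

lemma negligible_jump_times:
  assumes inj: "inj f" and k: "k \<noteq> 0" and neg: "negligible B"
  shows "negligible {s \<in> {a..T}. \<phi> (T - s) (\<phi> (s - a) z + k) \<in> B}" (is "negligible ?D")
proof (cases "a \<le> T")
  case False
  then show ?thesis by simp
next
  case True
  define F where "F s = \<phi> (T - s) (\<phi> (s - a) z + k)" for s
  \<comment> \<open>\<open>g (r, s)\<close> is the absolute speed at which the gap between two
    solutions changes after running for time \<open>r\<close>, when they start at
    \<open>\<phi> s z\<close> and at the same state displaced by \<open>k\<close>. Injectivity makes
    it nonzero, and compactness then yields the uniform bound \<open>c\<close>.\<close>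
  define g where "g p = (case p of (r, s) \<Rightarrow> \<bar>f (\<phi> r (\<phi> s z + k)) - f (\<phi> r (\<phi> s z))\<bar>)" for p
  let ?R = "{0..T - a} \<times> {0..T - a}"
  have g_pos: "0 < g p" if "p \<in> ?R" for p
  proof -
    obtain r s where p: "p = (r, s)" by (cases p)
    with that have r: "0 \<le> r" by auto
    have "0 < exp (- (L * r)) * \<bar>\<phi> s z + k - \<phi> s z\<bar>" using k by simp
    also have "\<dots> \<le> \<bar>\<phi> r (\<phi> s z + k) - \<phi> r (\<phi> s z)\<bar>" by (rule flow_lower[OF r])
    finally have "\<phi> r (\<phi> s z + k) \<noteq> \<phi> r (\<phi> s z)" by auto
    with inj show ?thesis by (auto simp: g_def p dest: injD)
  qed
  have "continuous_on ?R (\<lambda>p. f (\<phi> (fst p) (\<phi> (snd p) z + k)))"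
       "continuous_on ?R (\<lambda>p. f (\<phi> (fst p) (\<phi> (snd p) z)))"
    by (rule continuous_on_compose2[OF continuous_on_rhs[of UNIV]];
        auto intro!: continuous_intros)+
  then have "continuous_on ?R g"
    unfolding g_def split_beta by (intro continuous_intros)
  then have "\<exists>p\<in>?R. \<forall>q\<in>?R. g p \<le> g q"
    using True by (intro continuous_attains_inf compact_Times) auto
  then obtain c where c: "0 < c" "\<And>p. p \<in> ?R \<Longrightarrow> c \<le> g p"
    using g_pos by blast
  \<comment> \<open>The exponential is the most by which the flow over the remaining time, at most
    \<open>T - a\<close>, can shrink a difference.\<close>
  define C where "C = exp (- (L * (T - a))) * c"
  have C: "0 < C" using c by (simp add: C_def)
  have low: "C * (s' - s) \<le> \<bar>F s' - F s\<bar>" if s: "a \<le> s" "s < s'" "s' \<le> T" for s s'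
  proof -
    define d w where "d = s' - s" and "w = \<phi> (s - a) z"
    have d: "0 < d" using s by (simp add: d_def)
    have F: "F s = \<phi> (T - s') (\<phi> d (w + k))" "F s' = \<phi> (T - s') (\<phi> d w + k)"
      using flow_add[of d "T - s'" "w + k"] flow_add[of "s - a" d z] s
      by (simp_all add: F_def d_def w_def)
    \<comment> \<open>Since \<open>h 0 = k\<close>, the increment \<open>h d - h 0\<close> is
      exactly the discrepancy between jumping before and after the span \<open>d\<close>, and
      \<open>c\<close> bounds the absolute value of its derivative from below.\<close>
    define h where "h r = \<phi> r (w + k) - \<phi> r w" for r
    have dh: "(h has_real_derivative f (\<phi> r (w + k)) - f (\<phi> r w)) (at r within {0..d})"
      if "r \<in> {0..d}" for r
      unfolding h_def using that by (intro derivative_intros flow_deriv_Icc) auto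
    have "\<exists>r\<in>{0<..<d}. h d - h 0 = (f (\<phi> r (w + k)) - f (\<phi> r w)) * (d - 0)"
      using dh by (intro mvt_simple[OF d]) (auto simp: has_field_derivative_def)
    then obtain r where r: "0 < r" "r < d" "h d - h 0 = d * (f (\<phi> r (w + k)) - f (\<phi> r w))"
      by (auto simp: mult.commute)
    have "C * d \<le> exp (- (L * (T - s'))) * (c * d)"
      unfolding C_def mult.assoc using s c d lip_nonneg
      by (intro mult_right_mono) (auto intro: mult_left_mono)
    also have "c * d \<le> \<bar>h d - h 0\<bar>"
      using c(2)[of "(r, s - a)"] r s d by (simp add: g_def w_def d_def abs_mult)
    also have "h d - h 0 = \<phi> d (w + k) - (\<phi> d w + k)"
      by (simp add: h_def flow_0)
    also have "exp (- (L * (T - s'))) * \<bar>\<dots>\<bar> \<le> \<bar>F s - F s'\<bar>"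
      unfolding F using s by (intro flow_lower) auto
    finally show ?thesis by (simp add: d_def abs_minus_commute)
  qed
  have low': "\<bar>s' - s\<bar> \<le> (1 / C) * \<bar>F s' - F s\<bar>" if "s \<in> {a..T}" "s' \<in> {a..T}" for s s'
    using low[of s s'] low[of s' s] that C
    by (cases s s' rule: linorder_cases) (auto simp: field_simps abs_minus_commute)
  then have injF: "inj_on F {a..T}"
    by (force intro: inj_onI)
  \<comment> \<open>The set of jump times is recovered as the image of a subset of \<open>B\<close>
    under the inverse of \<open>F\<close>. Lipschitz maps preserve negligibility, whereas continuity
    of the inverse would not be enough.\<close>
  have "negligible (inv_into {a..T} F ` (F ` ?D))"
  proof (rule negligible_locally_Lipschitz_image)
    show "negligible (F ` ?D)"
      by (rule negligible_subset[OF neg]) (auto simp: F_def)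
    fix x assume "x \<in> F ` ?D"
    then show "\<exists>U B. open U \<and> x \<in> U \<and> (\<forall>y\<in>F ` ?D \<inter> U.
        norm (inv_into {a..T} F y - inv_into {a..T} F x) \<le> B * norm (y - x))"
      using injF low' by (intro exI[of _ UNIV] exI[of _ "1 / C"]) (auto simp: inv_into_f_f)
  qed simp
  also have "inv_into {a..T} F ` (F ` ?D) = ?D"
    using injF by (force simp: inv_into_f_f image_iff)
  finally show ?thesis .
qed

text \<open>The equation for \<open>Z\<close> is required only before \<open>q\<close>, because
  \<open>Z\<close> may jump at \<open>q\<close>; the conclusion concerns the value that
  \<open>Z\<close> would have there without the jump. The continuous \<open>U\<close> agrees with
  \<open>Z\<close> except possibly at \<open>q\<close>, a single point that the integral ignores, so
  \<open>U\<close> solves the equation on the closed interval.\<close>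

lemma flow_segment:
  assumes pq: "p \<le> q" and int: "(\<lambda>s. f (Z s)) integrable_on {p..q}"
    and Z: "\<And>t. t \<in> {p..<q} \<Longrightarrow> Z t = C + integral {p..t} (\<lambda>s. f (Z s))"
  shows "C + integral {p..q} (\<lambda>s. f (Z s)) = \<phi> (q - p) C"
proof -
  define U where "U t = C + integral {p..t} (\<lambda>s. f (Z s))" for t
  have U_cont: "continuous_on {p..q} U"
    unfolding U_def by (intro continuous_intros indefinite_integral_continuous_1 int)
  have fU: "continuous_on {p..q} (\<lambda>s. f (U s))"
    by (rule continuous_on_compose2[OF continuous_on_rhs[of UNIV] U_cont]) auto
  have U_eq: "U t = C + integral {p..t} (\<lambda>s. f (U s))" if "t \<in> {p..q}" for t
    unfolding U_def
    by (intro arg_cong2[of _ _ _ _ "(+)"] refl integral_spike[of "{q}"])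
      (use that Z in \<open>auto simp: U_def\<close>)
  have DU: "(U has_real_derivative f (U t)) (at t within {p..q})" if "t \<in> {p..q}" for t
  proof -
    have "((\<lambda>t. C + integral {p..t} (\<lambda>s. f (U s))) has_real_derivative f (U t)) (at t within {p..q})"
      using integral_has_real_derivative[OF fU that] by (auto intro!: derivative_eq_intros)
    then show ?thesis
      unfolding has_field_derivative_def
      by (rule has_derivative_transform[OF that, rotated]) (use U_eq in auto)
  qed
  have "U (p + (q - p)) = \<phi> (q - p) (U (p + 0))"
  proof (rule flow_unique)
    fix r assume r: "r \<in> {0..q - p}"
    have "(U has_real_derivative f (U (p + r))) (at (p + r) within (+) p ` {0..q - p})"
      using DU[of "p + r"] r by simp
    moreover have "((+) p has_real_derivative 1) (at r within {0..q - p})"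
      by (auto intro!: derivative_eq_intros)
    ultimately show "((\<lambda>t. U (p + t)) has_real_derivative f (U (p + r))) (at r within {0..q - p})"
      using DERIV_image_chain by (fastforce simp: o_def)
  qed (use pq in simp)
  then show ?thesis by (simp add: U_def)
qed

end

lemma lipschitz_flow_exists:
  assumes "L-lipschitz_on UNIV f"
  obtains \<phi> where "lipschitz_flow f L \<phi>"
proof -
  have "\<forall>z. \<exists>u. u 0 = z \<and> (\<forall>t\<ge>0. (u has_real_derivative f (u t)) (at t within {0..}))"
    using lipschitz_ode_exists[OF assms] by blast
  from choice[OF this] obtain u where
    "\<And>z. u z 0 = z" "\<And>z t. 0 \<le> t \<Longrightarrow> (u z has_real_derivative f (u z t)) (at t within {0..})"
    by blast
  then have "lipschitz_flow f L (\<lambda>t z. u z t)"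
    using assms by (intro lipschitz_flow.intro) auto
  then show ?thesis by (rule that)
qed

lemma differentiable_bounded_deriv_lipschitz:
  fixes f :: "real \<Rightarrow> real"
  assumes d: "\<And>u. f differentiable (at u)" and b: "bounded (range (deriv f))"
  obtains L where "L-lipschitz_on UNIV f"
proof -
  obtain L where L: "0 < L" "\<And>u. \<bar>deriv f u\<bar> \<le> L"
    using b by (auto simp: bounded_pos)
  have "L-lipschitz_on UNIV f"
  proof (rule bounded_derivative_imp_lipschitz)
    fix u
    show "(f has_derivative (*) (deriv f u)) (at u within UNIV)"
      using d[of u] by (metis DERIV_deriv_iff_real_differentiable has_field_derivative_def)
    show "onorm ((*) (deriv f u)) \<le> L"
      using L by (intro onorm_le) (simp add: abs_mult mult_right_mono)
  qed (use L in auto)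
  then show ?thesis by (rule that)
qed

section \<open>Paths with finitely many jumps and their Euler scheme\<close>

text \<open>One-sided limits bound the path near each point, and by compactness finitely many of
  these neighbourhoods cover \<open>{0..T}\<close>.\<close>

lemma cadlag_on_bounded:
  assumes "cadlag_on {0..T} g"
  obtains K where "\<And>t. t \<in> {0..T} \<Longrightarrow> \<bar>g t\<bar> \<le> K"
proof -
  have "\<exists>U K. open U \<and> t \<in> U \<and> (\<forall>s\<in>U \<inter> {0..T}. \<bar>g s\<bar> \<le> K)" if t: "t \<in> {0..T}" for t
  proof -
    obtain l where r: "(g \<longlongrightarrow> g t) (at t within {0..T} \<inter> {t..})"
      and l: "(g \<longlongrightarrow> l) (at t within {0..T} \<inter> {..<t})"
      using assms t unfolding cadlag_on_def continuous_within by blast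
    have "\<forall>\<^sub>F s in at t within {0..T} \<inter> {t..}. dist (g s) (g t) < 1"
         "\<forall>\<^sub>F s in at t within {0..T} \<inter> {..<t}. dist (g s) l < 1"
      using tendstoD[OF r, of 1] tendstoD[OF l, of 1] by auto
    then obtain U V where U: "open U" "t \<in> U" "\<forall>s\<in>U. s \<noteq> t \<longrightarrow> s \<in> {0..T} \<inter> {t..} \<longrightarrow> dist (g s) (g t) < 1"
      and V: "open V" "t \<in> V" "\<forall>s\<in>V. s \<noteq> t \<longrightarrow> s \<in> {0..T} \<inter> {..<t} \<longrightarrow> dist (g s) l < 1"
      unfolding eventually_at_topological by blast
    have "\<bar>g s\<bar> \<le> \<bar>g t\<bar> + \<bar>l\<bar> + 1" if s: "s \<in> U \<inter> V" "s \<in> {0..T}" for s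
    proof -
      consider "s = t" | "s > t" | "s < t" by linarith
      then show ?thesis
        using U(3) V(3) s by cases (force simp: dist_real_def)+
    qed
    with U V show ?thesis
      by (intro exI[of _ "U \<inter> V"] exI[of _ "\<bar>g t\<bar> + \<bar>l\<bar> + 1"]) auto
  qed
  then obtain U K where U: "\<And>t. t \<in> {0..T} \<Longrightarrow> open (U t) \<and> t \<in> U t \<and> (\<forall>s\<in>U t \<inter> {0..T}. \<bar>g s\<bar> \<le> K t)"
    by metis
  then have cov: "{0..T} \<subseteq> (\<Union>t\<in>{0..T}. U t)" by blast
  obtain C where C: "C \<subseteq> {0..T}" "finite C" "{0..T} \<subseteq> (\<Union>t\<in>C. U t)"
    by (rule compactE_image[OF compact_Icc _ cov]) (use U in auto)
  have "\<bar>g t\<bar> \<le> (\<Sum>c\<in>C. \<bar>K c\<bar>)" if t: "t \<in> {0..T}" for t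
  proof -
    obtain c where c: "c \<in> C" "t \<in> U c" using C(3) t by blast
    then have "\<bar>g t\<bar> \<le> K c" using U[of c] C(1) t by blast
    then have "\<bar>g t\<bar> \<le> \<bar>K c\<bar>" by linarith
    also have "\<dots> \<le> (\<Sum>c\<in>C. \<bar>K c\<bar>)" using C c by (intro member_le_sum) auto
    finally show ?thesis .
  qed
  then show ?thesis by (rule that)
qed

lemma cadlag_on_borel_measurable:
  assumes g: "cadlag_on {0..T} g"
  shows "(\<lambda>s. indicator {0..T} s *\<^sub>R g s) \<in> borel_measurable borel"
proof -
  \<comment> \<open>The \<open>+ 1\<close> rounds upwards, so \<open>q n s\<close> approaches
    \<open>s\<close> from the right, where the path is continuous; \<open>min T\<close> keeps it in
    the domain. As \<open>q n s\<close> depends on \<open>s\<close> only through an integer,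
    sampling at it is measurable for any \<open>g\<close>.\<close>
  define q where "q n s = min T ((of_int \<lfloor>s * Suc n\<rfloor> + 1) / real (Suc n))" for n and s :: real
  have q_meas: "(\<lambda>s. g (q n s)) \<in> borel_measurable borel" for n
  proof -
    have "(\<lambda>s. (\<lambda>k::int. g (min T ((of_int k + 1) / real (Suc n)))) \<lfloor>s * real (Suc n)\<rfloor>) \<in> borel_measurable borel"
      by (rule measurable_compose[where N="count_space UNIV"]) auto
    then show ?thesis by (simp add: q_def)
  qed
  have lim: "(\<lambda>n. g (q n s)) \<longlonglongrightarrow> g s" if s: "s \<in> {0..T}" for s
  proof -
    have q1: "s \<le> q n s" "q n s \<le> T" "q n s \<le> s + 1 / real (Suc n)" for n
    proof -
      have "s * real (Suc n) \<le> of_int \<lfloor>s * real (Suc n)\<rfloor> + 1" "of_int \<lfloor>s * real (Suc n)\<rfloor> \<le> s * real (Suc n)"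
        by linarith+
      then have "s \<le> (of_int \<lfloor>s * Suc n\<rfloor> + 1) / real (Suc n)"
        "(of_int \<lfloor>s * Suc n\<rfloor> + 1) / real (Suc n) \<le> s + 1 / real (Suc n)"
        by (simp_all add: field_simps del: of_nat_Suc)
      then show "s \<le> q n s" "q n s \<le> T" "q n s \<le> s + 1 / real (Suc n)"
        using s by (auto simp: q_def)
    qed
    have "(\<lambda>n. s + 1 / real (Suc n)) \<longlonglongrightarrow> s + 0"
      by (intro tendsto_intros LIMSEQ_Suc[OF lim_1_over_n])
    then have upper: "(\<lambda>n. s + 1 / real (Suc n)) \<longlonglongrightarrow> s"
      by simp
    have "(\<lambda>n. q n s) \<longlonglongrightarrow> s"
      by (rule tendsto_sandwich[OF always_eventually always_eventually tendsto_const upper])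
        (rule allI q1(1) q1(3))+
    moreover have "\<forall>n. q n s \<in> {0..T} \<inter> {s..}"
    proof
      fix n
      have "0 \<le> s" using s by simp
      then show "q n s \<in> {0..T} \<inter> {s..}"
        using q1(1,2)[of n] unfolding Int_iff atLeastAtMost_iff atLeast_iff by linarith
    qed
    moreover have "continuous (at s within ({0..T} \<inter> {s..})) g"
      using g s unfolding cadlag_on_def by blast
    ultimately show ?thesis
      unfolding continuous_within_sequentially o_def by (elim allE[of _ "\<lambda>n. q n s"]) simp
  qed
  show ?thesis
  proof (rule borel_measurable_LIMSEQ_real)
    fix s :: real
    show "(\<lambda>n. indicator {0..T} s *\<^sub>R g (q n s)) \<longlonglongrightarrow> indicator {0..T} s *\<^sub>R g s"
      using lim[of s] by (cases "s \<in> {0..T}") auto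
  qed (use q_meas in measurable)
qed

lemma cadlag_on_set_integrable:
  assumes g: "cadlag_on {0..T} g" and f: "continuous_on UNIV f" and t: "t \<le> T"
  shows "set_integrable lborel {0..t} (\<lambda>s. f (g s) :: real)"
proof -
  obtain K where K: "\<And>t. t \<in> {0..T} \<Longrightarrow> \<bar>g t\<bar> \<le> K"
    using cadlag_on_bounded[OF g] by metis
  have "compact (f ` {-K..K})"
    using f by (intro compact_continuous_image) (auto intro: continuous_on_subset)
  then obtain B where "\<forall>v\<in>f ` {-K..K}. norm v \<le> B"
    using compact_imp_bounded[of "f ` {-K..K}"] unfolding bounded_iff by blast
  then have B: "\<bar>f u\<bar> \<le> B" if "u \<in> {-K..K}" for u
    using that by auto
  have "(\<lambda>s. f (indicator {0..T} s *\<^sub>R g s)) \<in> borel_measurable borel"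
    using cadlag_on_borel_measurable[OF g] borel_measurable_continuous_onI[OF f]
    by (rule measurable_compose)
  then have "integrable lborel (\<lambda>s. indicator {0..t} s *\<^sub>R f (indicator {0..T} s *\<^sub>R g s))"
  proof (intro integrableI_bounded_set_indicator[where B=B])
    show "AE s in lborel. s \<in> {0..t} \<longrightarrow> norm (f (indicator {0..T} s *\<^sub>R g s)) \<le> B"
    proof (intro AE_I2 impI)
      fix s assume "s \<in> {0..t}"
      then have s: "s \<in> {0..T}" using t by auto
      have "g s \<in> {-K..K}" using K[OF s] by (auto simp: abs_le_iff)
      then show "norm (f (indicator {0..T} s *\<^sub>R g s)) \<le> B"
        using s B by simp
    qed
  qed (auto simp: emeasure_lborel_Icc_eq)
  also have "(\<lambda>s. indicator {0..t} s *\<^sub>R f (indicator {0..T} s *\<^sub>R g s)) = (\<lambda>s. indicator {0..t} s *\<^sub>R f (g s))"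
    using t by (auto simp: indicator_def)
  finally show ?thesis
    by (simp add: set_integrable_def)
qed

section \<open>The equation along a single path\<close>

text \<open>A deterministic form of the equation, with the jump times \<open>S\<close> and the jump
  sizes \<open>c\<close> as data. Integrability is part of it because a gauge integral takes a
  default value on functions that are not integrable.\<close>

definition jump_path ::
    "(real \<Rightarrow> real) \<Rightarrow> real set \<Rightarrow> (real \<Rightarrow> real) \<Rightarrow> real \<Rightarrow> real \<Rightarrow> (real \<Rightarrow> real) \<Rightarrow> bool" where
  "jump_path f S c x a Z \<longleftrightarrow> (\<lambda>s. f (Z s)) integrable_on {0..a} \<and>
     (\<forall>t\<in>{0..a}. Z t = x + integral {0..t} (\<lambda>s. f (Z s)) + (\<Sum>s\<in>S \<inter> {0<..t}. c s))"

lemma jump_pathD: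
  assumes "jump_path f S c x a Z"
  shows "(\<lambda>s. f (Z s)) integrable_on {0..a}"
    and "\<And>t. 0 \<le> t \<Longrightarrow> t \<le> a \<Longrightarrow>
      Z t = x + integral {0..t} (\<lambda>s. f (Z s)) + (\<Sum>s\<in>S \<inter> {0<..t}. c s)"
proof -
  show "(\<lambda>s. f (Z s)) integrable_on {0..a}"
    using assms unfolding jump_path_def by (rule conjunct1)
  fix t :: real assume "0 \<le> t" "t \<le> a"
  then have t: "t \<in> {0..a}" by simp
  show "Z t = x + integral {0..t} (\<lambda>s. f (Z s)) + (\<Sum>s\<in>S \<inter> {0<..t}. c s)"
    by (rule bspec[OF conjunct2[OF assms[unfolded jump_path_def]] t])
qed

lemma jump_path_integrable:
  assumes "jump_path f S c x a Z" "0 \<le> p" "q \<le> a"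
  shows "(\<lambda>s. f (Z s)) integrable_on {p..q}"
  using jump_pathD(1)[OF assms(1)] by (rule integrable_subinterval_real) (use assms(2,3) in auto)

lemma jump_path_mono:
  assumes Z: "jump_path f S c x a Z" and "b \<le> a"
  shows "jump_path f S c x b Z"
  unfolding jump_path_def
proof (intro conjI ballI)
  fix t assume "t \<in> {0..b}"
  with \<open>b \<le> a\<close> show "Z t = x + integral {0..t} (\<lambda>s. f (Z s)) + (\<Sum>s\<in>S \<inter> {0<..t}. c s)"
    by (intro jump_pathD(2)[OF Z]) auto
qed (intro jump_path_integrable[OF Z order_refl \<open>b \<le> a\<close>])

lemma jump_path_increment:
  assumes Z: "jump_path f S c x a Z" and S: "finite S" and pq: "0 \<le> p" "p \<le> q" "q \<le> a"
  shows "Z q = Z p + integral {p..q} (\<lambda>s. f (Z s)) + (\<Sum>s\<in>S \<inter> {p<..q}. c s)"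
proof -
  have "S \<inter> {0<..q} = (S \<inter> {0<..p}) \<union> (S \<inter> {p<..q})"
    using pq by auto
  then have "(\<Sum>s\<in>S \<inter> {0<..q}. c s) = (\<Sum>s\<in>S \<inter> {0<..p}. c s) + (\<Sum>s\<in>S \<inter> {p<..q}. c s)"
    using S by (simp only:) (intro sum.union_disjoint; auto)
  moreover have "(\<lambda>s. f (Z s)) integrable_on {0..q}"
    using pq by (intro jump_path_integrable[OF Z]) auto
  then have "integral {0..p} (\<lambda>s. f (Z s)) + integral {p..q} (\<lambda>s. f (Z s)) = integral {0..q} (\<lambda>s. f (Z s))"
    using pq by (intro Henstock_Kurzweil_Integration.integral_combine) auto
  moreover note jump_pathD(2)[OF Z, of q] jump_pathD(2)[OF Z, of p]
  ultimately show ?thesis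
    using pq by linarith
qed

lemma (in lipschitz_flow) jump_path_single_jump:
  assumes Z: "jump_path f S c x T Z" and S: "finite S" and a: "0 \<le> a"
    and single: "S \<inter> {a<..T} = {\<tau>}"
  shows "Z T = \<phi> (T - \<tau>) (\<phi> (\<tau> - a) (Z a) + c \<tau>)"
proof -
  have "\<tau> \<in> S \<inter> {a<..T}" unfolding single by simp
  then have \<tau>: "a < \<tau>" "\<tau> \<le> T" and mem1: "\<tau> \<in> S" by auto
  have int: "(\<lambda>s. f (Z s)) integrable_on {p..q}" if "0 \<le> p" "q \<le> T" for p q
    using that by (intro jump_path_integrable[OF Z]) auto
  have mem2: "s = \<tau>" if "s \<in> S" "a < s" "s \<le> T" for s
  proof -
    have "s \<in> S \<inter> {a<..T}" using that by simp
    then show ?thesis unfolding single by simp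
  qed
  have eq1: "S \<inter> {a<..t} = {}" if "t < \<tau>" for t
  proof (rule equals0I)
    fix s assume "s \<in> S \<inter> {a<..t}"
    then show False using mem2[of s] that \<tau> by auto
  qed
  have eq2: "S \<inter> {\<tau><..t} = {}" if "t \<le> T" for t
  proof (rule equals0I)
    fix s assume "s \<in> S \<inter> {\<tau><..t}"
    then show False using mem2[of s] that \<tau> by auto
  qed
  have eq3: "S \<inter> {a<..\<tau>} = {\<tau>}"
  proof (intro equalityI subsetI)
    fix s assume "s \<in> S \<inter> {a<..\<tau>}"
    then show "s \<in> {\<tau>}" using mem2[of s] \<tau> by auto
  qed (use mem1 \<tau> in auto)
  have 1: "Z t = Z a + integral {a..t} (\<lambda>s. f (Z s))" if "t \<in> {a..<\<tau>}" for t
    using jump_path_increment[OF Z S, of a t] eq1[of t] that \<tau> a by auto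
  have 2: "Z t = Z \<tau> + integral {\<tau>..t} (\<lambda>s. f (Z s))" if "t \<in> {\<tau>..T}" for t
    using jump_path_increment[OF Z S, of \<tau> t] eq2[of t] that \<tau> a by auto
  have "Z a + integral {a..\<tau>} (\<lambda>s. f (Z s)) = \<phi> (\<tau> - a) (Z a)"
    using \<tau> a by (intro flow_segment int 1) auto
  moreover have "Z \<tau> + integral {\<tau>..T} (\<lambda>s. f (Z s)) = \<phi> (T - \<tau>) (Z \<tau>)"
    using \<tau> a by (intro flow_segment int 2) auto
  moreover have "Z \<tau> = Z a + integral {a..\<tau>} (\<lambda>s. f (Z s)) + c \<tau>"
    using jump_path_increment[OF Z S, of a \<tau>] \<tau> a eq3 by auto
  moreover have "Z T = Z \<tau> + integral {\<tau>..T} (\<lambda>s. f (Z s))"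
    using 2[of T] \<tau> by auto
  ultimately show ?thesis by metis
qed

section \<open>Convergence of the Euler scheme\<close>

primrec euler :: "(real \<Rightarrow> real) \<Rightarrow> real \<Rightarrow> (nat \<Rightarrow> real) \<Rightarrow> real \<Rightarrow> nat \<Rightarrow> real" where
  "euler f d c x 0 = x"
| "euler f d c x (Suc i) = euler f d c x i + d * f (euler f d c x i) + c i"

text \<open>Within one cell \<open>Z\<close> moves by at most \<open>d * K\<close> plus the sizes of
  the jumps in it, and this displacement acts on the drift for time \<open>d\<close> only. So a jump
  costs \<open>d * L * \<bar>c s\<bar>\<close> besides the error in its size, and each step costs
  \<open>d * d * L * K\<close>. Earlier errors grow by the factor
  \<open>1 + L * d \<le> exp (L * d)\<close> per step.\<close>

lemma (in lipschitz_flow) euler_error: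
  fixes i :: nat and d :: real and c' :: "real \<Rightarrow> real"
  assumes Z: "jump_path f S c x a Z" and S: "finite S" and d: "0 \<le> d"
    and K: "\<And>t. t \<in> {0..a} \<Longrightarrow> \<bar>f (Z t)\<bar> \<le> K" and i: "d * i \<le> a"
  defines "E \<equiv> euler f d (\<lambda>i. \<Sum>s\<in>S \<inter> {d * i<..d * Suc i}. c' s) x"
  shows "\<bar>Z (d * i) - E i\<bar> \<le>
    exp (L * (d * i)) * ((\<Sum>s\<in>S \<inter> {0<..d * i}. d * L * \<bar>c s\<bar> + \<bar>c s - c' s\<bar>) + d * d * L * K * i)"
  using i
proof (induction i)
  case 0
  have "Z 0 = x" using jump_pathD(2)[OF Z, of 0] 0 by simp
  then show ?case by (simp add: E_def)
next
  case (Suc i)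
  define p q where "p = d * i" and "q = d * Suc i"
  have pq: "0 \<le> p" "p \<le> q" "q \<le> a" "q - p = d"
  proof -
    have q: "q = p + d" by (simp add: p_def q_def distrib_left)
    show "0 \<le> p" using d by (simp add: p_def)
    show "p \<le> q" "q - p = d" using d q by auto
    show "q \<le> a" using Suc.prems by (simp only: q_def)
  qed
  let ?C = "S \<inter> {p<..q}"
  define b where "b s = d * L * \<bar>c s\<bar> + \<bar>c s - c' s\<bar>" for s
  define e where "e = \<bar>Z p - E i\<bar>"
  have int: "(\<lambda>s. f (Z s)) integrable_on {r..t}" if "0 \<le> r" "t \<le> a" for r t
    using that by (intro jump_path_integrable[OF Z]) auto
  have "0 \<in> {0..a}" using pq by auto
  then have K0: "0 \<le> K" using K[of 0] by linarith
  have osc: "\<bar>Z t - Z p\<bar> \<le> d * K + (\<Sum>s\<in>?C. \<bar>c s\<bar>)" if t: "t \<in> {p..q}" for t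
  proof -
    have "norm (integral {p..t} (\<lambda>s. f (Z s))) \<le> integral {p..t} (\<lambda>_. K)"
      using t pq K by (intro integral_norm_bound_integral int) auto
    also have "\<dots> = (t - p) * K" using t by simp
    also have "\<dots> \<le> d * K" using t pq K0 by (intro mult_right_mono) auto
    finally have 1: "\<bar>integral {p..t} (\<lambda>s. f (Z s))\<bar> \<le> d * K" by simp
    have "\<bar>\<Sum>s\<in>S \<inter> {p<..t}. c s\<bar> \<le> (\<Sum>s\<in>S \<inter> {p<..t}. \<bar>c s\<bar>)" by (rule sum_abs)
    also have "\<dots> \<le> (\<Sum>s\<in>?C. \<bar>c s\<bar>)" using S t by (intro sum_mono2) auto
    finally show ?thesis
      using jump_path_increment[OF Z S, of p t] 1 t pq unfolding atLeastAtMost_iff by linarith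
  qed
  have "norm (integral {p..q} (\<lambda>s. f (Z s) - f (E i)))
      \<le> integral {p..q} (\<lambda>_. L * (e + (d * K + (\<Sum>s\<in>?C. \<bar>c s\<bar>))))"
  proof (intro integral_norm_bound_integral)
    fix t assume t: "t \<in> {p..q}"
    have "\<bar>f (Z t) - f (E i)\<bar> \<le> L * \<bar>Z t - E i\<bar>" by (rule lip_bound)
    also have "\<dots> \<le> L * (e + (d * K + (\<Sum>s\<in>?C. \<bar>c s\<bar>)))"
      using osc[OF t] lip_nonneg by (intro mult_left_mono) (auto simp: e_def)
    finally show "norm (f (Z t) - f (E i)) \<le> L * (e + (d * K + (\<Sum>s\<in>?C. \<bar>c s\<bar>)))" by simp
  qed (use pq in \<open>auto intro!: integrable_diff int\<close>)
  also have "\<dots> = d * (L * (e + (d * K + (\<Sum>s\<in>?C. \<bar>c s\<bar>))))"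
    using pq by simp
  also have "integral {p..q} (\<lambda>s. f (Z s) - f (E i)) = integral {p..q} (\<lambda>s. f (Z s)) - d * f (E i)"
    using pq int[of p q] by (subst integral_diff) auto
  finally have 1: "\<bar>integral {p..q} (\<lambda>s. f (Z s)) - d * f (E i)\<bar> \<le> d * (L * (e + (d * K + (\<Sum>s\<in>?C. \<bar>c s\<bar>))))"
    by simp
  have 2: "\<bar>(\<Sum>s\<in>?C. c s) - (\<Sum>s\<in>?C. c' s)\<bar> \<le> (\<Sum>s\<in>?C. \<bar>c s - c' s\<bar>)"
    by (simp add: sum_abs flip: sum_subtractf)
  have "E (Suc i) = E i + d * f (E i) + (\<Sum>s\<in>?C. c' s)"
    by (simp add: E_def p_def q_def)
  then have "Z q - E (Suc i) = (Z p - E i) + (integral {p..q} (\<lambda>s. f (Z s)) - d * f (E i))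
      + ((\<Sum>s\<in>?C. c s) - (\<Sum>s\<in>?C. c' s))"
    using jump_path_increment[OF Z S pq(1,2,3)] by linarith
  then have "\<bar>Z q - E (Suc i)\<bar> \<le> e + d * (L * (e + (d * K + (\<Sum>s\<in>?C. \<bar>c s\<bar>)))) + (\<Sum>s\<in>?C. \<bar>c s - c' s\<bar>)"
    using 1 2 unfolding e_def by linarith
  also have "\<dots> = (1 + L * d) * e + ((\<Sum>s\<in>?C. b s) + d * d * L * K)"
    by (simp add: b_def sum.distrib algebra_simps flip: sum_distrib_left)
  \<comment> \<open>Enlarging the fresh errors by \<open>exp (L * q) \<ge> 1\<close> puts old and
    new contributions under one exponential, which closes the induction.\<close>
  also have "\<dots> \<le> exp (L * d) * e + exp (L * q) * ((\<Sum>s\<in>?C. b s) + d * d * L * K)"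
  proof (rule add_mono)
    show "(1 + L * d) * e \<le> exp (L * d) * e"
      by (intro mult_right_mono exp_ge_add_one_self) (simp add: e_def)
    have "0 \<le> (\<Sum>s\<in>?C. b s) + d * d * L * K"
      using d lip_nonneg K0 by (intro add_nonneg_nonneg sum_nonneg) (auto simp: b_def)
    moreover have "1 \<le> exp (L * q)" using lip_nonneg pq by simp
    ultimately show "(\<Sum>s\<in>?C. b s) + d * d * L * K \<le> exp (L * q) * ((\<Sum>s\<in>?C. b s) + d * d * L * K)"
      by (simp add: mult_le_cancel_right1)
  qed
  also have "e \<le> exp (L * p) * ((\<Sum>s\<in>S \<inter> {0<..p}. b s) + d * d * L * K * i)"
    using Suc pq by (simp add: e_def p_def b_def q_def)
  also have "exp (L * d) * (exp (L * p) * ((\<Sum>s\<in>S \<inter> {0<..p}. b s) + d * d * L * K * i))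
     + exp (L * q) * ((\<Sum>s\<in>?C. b s) + d * d * L * K)
     = exp (L * q) * (((\<Sum>s\<in>S \<inter> {0<..p}. b s) + (\<Sum>s\<in>?C. b s)) + d * d * L * K * Suc i)"
  proof -
    have alg: "E1 * (E2 * (X + k * j)) + E3 * (Y + k) = E3 * ((X + Y) + k * (j + 1))"
      if "E1 * E2 = E3" for E1 E2 E3 X Y k j :: real
      unfolding that[symmetric] by (simp add: algebra_simps)
    have "L * d + L * p = L * q"
      using pq(4) by (simp flip: distrib_left)
    then have "exp (L * d) * exp (L * p) = exp (L * q)"
      by (simp flip: exp_add)
    from alg[OF this] show ?thesis by (simp only: of_nat_Suc add.commute)
  qed
  also have "(\<Sum>s\<in>S \<inter> {0<..p}. b s) + (\<Sum>s\<in>?C. b s) = (\<Sum>s\<in>S \<inter> {0<..q}. b s)"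
  proof -
    have "S \<inter> {0<..q} = (S \<inter> {0<..p}) \<union> ?C" using pq by auto
    then show ?thesis using S by (simp only:) (intro sum.union_disjoint[symmetric]; auto)
  qed
  finally show ?case by (simp add: q_def b_def)
qed

text \<open>\<open>Suc n\<close> steps of size \<open>a / Suc n\<close> end exactly at
  \<open>a\<close>. The accumulated truncation error is of order \<open>d n\<close>, and because
  \<open>S\<close> is finite, pointwise convergence of the jump sizes is enough.\<close>

lemma (in lipschitz_flow) euler_tendsto:
  fixes d :: "nat \<Rightarrow> real" and c' :: "nat \<Rightarrow> real \<Rightarrow> real"
  assumes Z: "jump_path f S c x a Z" and S: "finite S" and a: "0 \<le> a"
    and K: "\<And>t. t \<in> {0..a} \<Longrightarrow> \<bar>f (Z t)\<bar> \<le> K"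
    and c': "\<And>s. s \<in> S \<Longrightarrow> (\<lambda>n. c' n s) \<longlonglongrightarrow> c s"
    and d: "\<And>n. d n = a / real (Suc n)"
  shows "(\<lambda>n. euler f (d n) (\<lambda>i. \<Sum>s\<in>S \<inter> {d n * i<..d n * Suc i}. c' n s) x (Suc n)) \<longlonglongrightarrow> Z a"
proof -
  let ?E = "\<lambda>n. euler f (d n) (\<lambda>i. \<Sum>s\<in>S \<inter> {d n * i<..d n * Suc i}. c' n s) x (Suc n)"
  let ?B = "\<lambda>n. exp (L * a) * ((\<Sum>s\<in>S \<inter> {0<..a}. d n * L * \<bar>c s\<bar> + \<bar>c s - c' n s\<bar>) + d n * (L * K * a))"
  have da: "d n * real (Suc n) = a" for n by (simp add: d)
  have "(\<lambda>n. a * (1 / real (Suc n))) \<longlonglongrightarrow> a * 0"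
    by (intro tendsto_intros LIMSEQ_Suc[OF lim_1_over_n])
  moreover have "d = (\<lambda>n. a * (1 / real (Suc n)))"
    by (simp add: fun_eq_iff d)
  ultimately have d0: "d \<longlonglongrightarrow> 0"
    by simp
  have "?B \<longlonglongrightarrow> exp (L * a) * ((\<Sum>s\<in>S \<inter> {0<..a}. 0 * L * \<bar>c s\<bar> + \<bar>c s - c s\<bar>) + 0 * (L * K * a))"
    by (intro tendsto_intros d0 c') auto
  then have B: "?B \<longlonglongrightarrow> 0" by simp
  have "\<bar>Z a - ?E n\<bar> \<le> ?B n" for n
  proof -
    have "d n * d n * L * K * real (Suc n) = (d n * real (Suc n)) * d n * L * K"
      by (simp only: mult_ac)
    also have "\<dots> = d n * (L * K * a)" by (simp add: da del: of_nat_Suc)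
    finally have "d n * d n * L * K * real (Suc n) = d n * (L * K * a)" .
    moreover have "0 \<le> d n" using a d[of n] by simp
    note euler_error[OF Z S this K, of "Suc n" "c' n", unfolded da]
    ultimately show ?thesis
      by (simp only:)
  qed
  then have "(\<lambda>n. ?E n - Z a) \<longlonglongrightarrow> 0"
    by (intro Lim_null_comparison[OF _ B] always_eventually) (simp add: abs_minus_commute)
  then show ?thesis by (rule LIM_zero_cancel)
qed

text \<open>The jump measure is an image of counting measure on the jump times, so finitely many
  jumps turn the integral into a sum. Closing the interval at 0 changes nothing, since all counted
  jumps have positive time.\<close>

lemma integral_jump_measure_Icc:
  assumes h: "h \<in> borel_measurable borel" and fin: "finite S"
    and S: "S = {t. 0 < t \<and> t \<le> T \<and> jump y t \<noteq> 0}" and t: "t \<le> T"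
  shows "(LINT p:{0..t} \<times> (-{0})|jump_measure y. h (snd p)) = (\<Sum>s\<in>S \<inter> {0<..t}. h (jump y s) :: real)"
proof -
  let ?J = "{t. 0 < t \<and> jump y t \<noteq> 0}"
  let ?g = "\<lambda>p. indicator ({0..t} \<times> (-{0})) p *\<^sub>R h (snd p)"
  have S_iff: "s \<in> S \<longleftrightarrow> 0 < s \<and> s \<le> T \<and> jump y s \<noteq> 0" for s
    by (simp add: S)
  have "?g \<in> borel_measurable (borel \<Otimes>\<^sub>M borel)"
    using h by measurable
  then have "?g \<in> borel_measurable borel"
    by (simp only: borel_prod)
  then have "(LINT p:{0..t} \<times> (-{0})|jump_measure y. h (snd p)) = (\<integral>s. ?g (s, jump y s) \<partial>count_space ?J)"
    unfolding set_lebesgue_integral_def jump_measure_def by (subst integral_distr) auto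
  also have "\<dots> = (\<Sum>s | s \<in> ?J \<and> ?g (s, jump y s) \<noteq> 0. ?g (s, jump y s))"
  proof (rule lebesgue_integral_count_space_finite_support)
    have "{s \<in> ?J. ?g (s, jump y s) \<noteq> 0} \<subseteq> S"
      using t by (auto simp: S_iff indicator_def split: if_splits)
    then show "finite {s \<in> ?J. ?g (s, jump y s) \<noteq> 0}"
      using fin by (rule finite_subset)
  qed
  also have "\<dots> = (\<Sum>s\<in>S \<inter> {0<..t}. h (jump y s))"
    using fin t by (intro sum.mono_neutral_cong_left) (auto simp: S_iff indicator_def split: if_splits)
  finally show ?thesis .
qed

section \<open>Independence of past and future\<close>

lemma (in prob_space) indep_vars_reindex_inj:
  assumes ind: "indep_vars M' X (g ` I)" and inj: "inj_on g I"
  shows "indep_vars (\<lambda>i. M' (g i)) (\<lambda>i. X (g i)) I"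
  unfolding indep_vars_def2
proof
  show "\<forall>i\<in>I. random_variable (M' (g i)) (X (g i))"
    using ind unfolding indep_vars_def2 by blast
  show "indep_sets (\<lambda>i. {X (g i) -` A \<inter> space M |A. A \<in> sets (M' (g i))}) I"
    unfolding indep_sets_def
  proof (intro conjI ballI allI impI)
    fix i assume "i \<in> I"
    then show "{X (g i) -` A \<inter> space M |A. A \<in> sets (M' (g i))} \<subseteq> events"
      using ind unfolding indep_vars_def2 by (auto intro: measurable_sets)
  next
    fix J A assume J: "J \<subseteq> I" "J \<noteq> {}" "finite J"
      and A: "A \<in> (\<Pi> j\<in>J. {X (g j) -` A \<inter> space M |A. A \<in> sets (M' (g j))})"
    have injJ: "inj_on g J" using inj J(1) by (rule inj_on_subset)
    define B where "B k = A (inv_into J g k)" for k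
    have B: "B (g j) = A j" if "j \<in> J" for j
      using injJ that by (simp add: B_def)
    have "indep_sets (\<lambda>i. {X i -` A \<inter> space M |A. A \<in> sets (M' i)}) (g ` I)"
      using ind unfolding indep_vars_def2 by blast
    then have "prob (\<Inter>k\<in>g ` J. B k) = (\<Prod>k\<in>g ` J. prob (B k))"
      using J A B by (intro indep_setsD) auto
    then show "prob (\<Inter>j\<in>J. A j) = (\<Prod>j\<in>J. prob (A j))"
      using B injJ by (simp add: prod.reindex)
  qed
qed

section \<open>Counts of a Poisson random measure\<close>

text \<open>The definition speaks of sequences of disjoint sets; a countable family is enumerated
  and padded with empty sets.\<close>

lemma poisson_random_measure_indep_vars:
  assumes "prob_space M" and N: "poisson_random_measure M N \<mu>"
    and I: "countable I" and disj: "disjoint_family_on A I" and A: "\<And>i. i \<in> I \<Longrightarrow> A i \<in> sets \<mu>"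
  shows "prob_space.indep_vars M (\<lambda>_. borel) (\<lambda>i \<omega>. emeasure (N \<omega>) (A i)) I"
proof -
  interpret prob_space M by fact
  let ?g = "to_nat_on I"
  define B where "B n = (if n \<in> ?g ` I then A (inv_into I ?g n) else {})" for n
  have B: "B (?g i) = A i" if "i \<in> I" for i
    using that inj_on_to_nat_on[OF I] by (simp add: B_def)
  have "range B \<subseteq> sets \<mu>"
    using A inj_on_to_nat_on[OF I] by (auto simp: B_def)
  moreover have "B m \<inter> B n = {}" if "m \<noteq> n" for m n
  proof (cases "m \<in> ?g ` I \<and> n \<in> ?g ` I")
    case True
    then obtain i j where ij: "i \<in> I" "j \<in> I" "m = ?g i" "n = ?g j" by auto
    with that have "i \<noteq> j" by auto
    then show ?thesis
      using disj ij by (simp add: B disjoint_family_on_def)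
  qed (auto simp: B_def)
  then have "disjoint_family B"
    by (simp add: disjoint_family_on_def)
  ultimately have "indep_vars (\<lambda>_. borel) (\<lambda>n \<omega>. emeasure (N \<omega>) (B n)) UNIV"
    using N unfolding poisson_random_measure_def by blast
  then have "indep_vars (\<lambda>_. borel) (\<lambda>n \<omega>. emeasure (N \<omega>) (B n)) (?g ` I)"
    by (rule indep_vars_subset) simp
  from indep_vars_reindex_inj[OF this inj_on_to_nat_on[OF I]]
  show ?thesis
    by (rule iffD1[OF indep_vars_cong, rotated -1]) (auto simp: B)
qed

lemma poisson_random_measure_measurable:
  assumes "poisson_random_measure M N \<mu>" "A \<in> sets \<mu>"
  shows "(\<lambda>\<omega>. emeasure (N \<omega>) A) \<in> borel_measurable M"
  using assms unfolding poisson_random_measure_def by blast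

lemma poisson_random_measure_prob:
  assumes "poisson_random_measure M N \<mu>" "A \<in> sets \<mu>" "emeasure \<mu> A < \<infinity>"
  shows "measure M {\<omega>\<in>space M. emeasure (N \<omega>) A = of_nat n} =
    measure \<mu> A ^ n / fact n * exp (- measure \<mu> A)"
  using assms unfolding poisson_random_measure_def by blast

text \<open>The Poisson weights sum to 1, which leaves no mass for infinite or non-integer
  values.\<close>

lemma poisson_random_measure_AE_finite:
  assumes "prob_space M" and N: "poisson_random_measure M N \<mu>"
    and A: "A \<in> sets \<mu>" "emeasure \<mu> A < \<infinity>"
  shows "AE \<omega> in M. \<exists>n::nat. emeasure (N \<omega>) A = of_nat n"
proof -
  interpret prob_space M by fact
  let ?E = "\<lambda>n. {\<omega>\<in>space M. emeasure (N \<omega>) A = of_nat n}"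
  have [measurable]: "(\<lambda>\<omega>. emeasure (N \<omega>) A) \<in> borel_measurable M"
    by (rule poisson_random_measure_measurable[OF N A(1)])
  have "(\<lambda>n. prob (?E n)) sums prob (\<Union>n. ?E n)"
    by (rule finite_measure_UNION) (auto simp: disjoint_family_on_def)
  moreover have "(\<lambda>n. exp (- measure \<mu> A) * (measure \<mu> A ^ n /\<^sub>R fact n)) sums (exp (- measure \<mu> A) * exp (measure \<mu> A))"
    by (intro sums_mult exp_converges)
  then have "(\<lambda>n. prob (?E n)) sums 1"
    by (simp add: poisson_random_measure_prob[OF N A] divide_inverse mult_ac exp_minus)
  ultimately have "prob (\<Union>n. ?E n) = 1"
    by (rule sums_unique2)
  then have "AE \<omega> in M. \<omega> \<in> (\<Union>n. ?E n)"
    by (intro prob_eq_1[THEN iffD1]) auto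
  then show ?thesis by eventually_elim auto
qed

text \<open>Meant for a partition of a set \<open>R\<close> into \<open>C\<close> and
  \<open>C'\<close>: the event then says that \<open>R\<close> carries exactly one point and that
  this point lies in \<open>C\<close>. With \<open>R\<close> fixed, the probability is proportional
  to \<open>measure \<mu> C\<close>, which identifies the law of the point.\<close>

lemma poisson_random_measure_single_point:
  assumes "prob_space M" and N: "poisson_random_measure M N \<mu>"
    and C: "C \<in> sets \<mu>" "C' \<in> sets \<mu>" "C \<inter> C' = {}"
    and fin: "emeasure \<mu> C < \<infinity>" "emeasure \<mu> C' < \<infinity>"
  shows "measure M {\<omega>\<in>space M. emeasure (N \<omega>) C = 1 \<and> emeasure (N \<omega>) C' = 0} =
    measure \<mu> C * exp (- (measure \<mu> C + measure \<mu> C'))"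
proof -
  interpret prob_space M by fact
  let ?A = "\<lambda>b. if b then C else C'" and ?V = "\<lambda>b. {if b then 1 else 0 :: ennreal}"
  let ?X = "\<lambda>b \<omega>. emeasure (N \<omega>) (?A b)"
  have "indep_vars (\<lambda>_. borel) ?X (UNIV :: bool set)"
    using C by (intro poisson_random_measure_indep_vars[OF \<open>prob_space M\<close> N]) (auto simp: disjoint_family_on_def)
  then have "prob (\<Inter>b\<in>UNIV. ?X b -` ?V b \<inter> space M) = (\<Prod>b\<in>UNIV. prob (?X b -` ?V b \<inter> space M))"
    by (rule indep_varsD_finite) auto
  moreover have "(\<Inter>b\<in>UNIV. ?X b -` ?V b \<inter> space M) =
      {\<omega>\<in>space M. emeasure (N \<omega>) C = 1 \<and> emeasure (N \<omega>) C' = 0}"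
    by (auto simp: UNIV_bool)
  moreover have "?X True -` ?V True \<inter> space M = {\<omega>\<in>space M. emeasure (N \<omega>) C = of_nat 1}"
    "?X False -` ?V False \<inter> space M = {\<omega>\<in>space M. emeasure (N \<omega>) C' = of_nat 0}"
    by auto
  ultimately have "prob {\<omega>\<in>space M. emeasure (N \<omega>) C = 1 \<and> emeasure (N \<omega>) C' = 0} =
    prob {\<omega>\<in>space M. emeasure (N \<omega>) C = of_nat 1} * prob {\<omega>\<in>space M. emeasure (N \<omega>) C' = of_nat 0}"
    by (simp only: UNIV_bool) (simp add: mult.commute)
  also have "\<dots> = measure \<mu> C * exp (- (measure \<mu> C + measure \<mu> C'))"
    using C fin unfolding poisson_random_measure_prob[OF N C(1) fin(1)] poisson_random_measure_prob[OF N C(2) fin(2)]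
    by (simp add: mult_exp_exp)
  finally show ?thesis .
qed

text \<open>Independence from \<open>D\<close> means that conditioning on \<open>D\<close> does not
  change the law. The events \<open>U n \<in> A\<close> need not converge, but characteristic
  functions do, by dominated convergence under both measures, and they determine the law of the
  limit.\<close>

lemma (in prob_space) indep_event_limit:
  fixes U :: "nat \<Rightarrow> 'a \<Rightarrow> real"
  assumes D: "D \<in> events"
    and Un: "\<And>n. U n \<in> borel_measurable M" and V: "V \<in> borel_measurable M"
    and lim: "AE \<omega> in M. (\<lambda>n. U n \<omega>) \<longlonglongrightarrow> V \<omega>"
    and ind: "\<And>n A. A \<in> sets borel \<Longrightarrow> prob (D \<inter> (U n -` A \<inter> space M)) = prob D * prob (U n -` A \<inter> space M)"
    and A: "A \<in> sets borel"
  shows "prob (D \<inter> (V -` A \<inter> space M)) = prob D * prob (V -` A \<inter> space M)"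
proof (cases "prob D = 0")
  case True
  have "prob (D \<inter> (V -` A \<inter> space M)) \<le> prob D"
    using D by (intro finite_measure_mono) auto
  with True show ?thesis by (simp add: measure_le_0_iff)
next
  case False
  define P where "P = uniform_measure M D"
  have D': "emeasure M D \<noteq> 0" "emeasure M D \<noteq> \<infinity>"
    using False by (auto simp: emeasure_eq_measure)
  interpret P: prob_space P
    unfolding P_def by (rule prob_space_uniform_measure[OF D'])
  have sP [measurable_cong]: "sets P = sets M" by (simp add: P_def)
  note [measurable] = Un V
  have mP: "measure P B = prob (D \<inter> B) / prob D" if "B \<in> events" for B
    unfolding P_def by (rule measure_uniform_measure[OF D' that])
  have "distr P borel (U n) = distr M borel (U n)" for n
  proof (rule measure_eqI)
    fix B assume "B \<in> sets (distr P borel (U n))"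
    then have [measurable]: "B \<in> sets borel" by simp
    have "measure P (U n -` B \<inter> space M) = prob (U n -` B \<inter> space M)"
      using False by (subst mP) (auto simp: ind)
    moreover have "space P = space M" by (simp add: P_def)
    ultimately show "emeasure (distr P borel (U n)) B = emeasure (distr M borel (U n)) B"
      by (simp add: emeasure_distr emeasure_eq_measure P.emeasure_eq_measure)
  qed simp
  then have eq: "(\<integral>\<omega>. iexp (t * U n \<omega>) \<partial>P) = (\<integral>\<omega>. iexp (t * U n \<omega>) \<partial>M)" for t n
    by (subst (1 2) integral_distr[of "U n" _ borel "\<lambda>x. iexp (t * x)", symmetric]) auto
  have limP: "AE \<omega> in P. (\<lambda>n. U n \<omega>) \<longlonglongrightarrow> V \<omega>"
    unfolding P_def using lim D by (intro AE_uniform_measureI) auto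
  have L: "(\<lambda>n. \<integral>\<omega>. iexp (t * U n \<omega>) \<partial>Q) \<longlonglongrightarrow> (\<integral>\<omega>. iexp (t * V \<omega>) \<partial>Q)"
    if "prob_space Q" and [measurable_cong]: "sets Q = sets M" and "AE \<omega> in Q. (\<lambda>n. U n \<omega>) \<longlonglongrightarrow> V \<omega>" for t Q
  proof (rule integral_dominated_convergence[where w="\<lambda>_. 1"])
    interpret Q: prob_space Q by fact
    show "integrable Q (\<lambda>_. 1 :: real)" by simp
    show "AE \<omega> in Q. (\<lambda>n. iexp (t * U n \<omega>)) \<longlonglongrightarrow> iexp (t * V \<omega>)"
      using that(3) by eventually_elim (auto intro!: tendsto_intros)
  qed auto
  have "char (distr P borel V) = char (distr M borel V)"
  proof
    fix t
    have "(\<integral>\<omega>. iexp (t * V \<omega>) \<partial>P) = (\<integral>\<omega>. iexp (t * V \<omega>) \<partial>M)"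
      using L[OF P.prob_space_axioms sP limP, of t] L[OF prob_space_axioms refl lim, of t]
      unfolding eq by (rule LIMSEQ_unique)
    then show "char (distr P borel V) t = char (distr M borel V) t"
      unfolding char_def by (subst (1 2) integral_distr) auto
  qed
  then have "distr P borel V = distr M borel V"
    by (intro Levy_uniqueness P.real_distribution_distr real_distribution_distr) auto
  then have "measure P (V -` A \<inter> space M) = prob (V -` A \<inter> space M)"
    using A measure_distr[of V P borel A] measure_distr[of V M borel A] by (simp add: P_def)
  then show ?thesis
    using False A by (subst (asm) mP) (auto simp: field_simps)
qed

section \<open>Independence for the Euler scheme\<close>

lemma euler_cong:
  "(\<And>i. i < m \<Longrightarrow> c i = c' i) \<Longrightarrow> euler f d c x m = euler f d c' x m"
  by (induction m) auto

lemma measurable_euler: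
  assumes f: "f \<in> borel_measurable borel" and c: "\<And>i. i < m \<Longrightarrow> (\<lambda>e. c e i) \<in> borel_measurable M"
  shows "(\<lambda>e. euler f d (c e) x m) \<in> borel_measurable M"
  using c
proof (induction m)
  case (Suc m)
  have [measurable]: "(\<lambda>e. euler f d (c e) x m) \<in> borel_measurable M" "(\<lambda>e. c e m) \<in> borel_measurable M"
    using Suc by auto
  note [measurable] = f
  show ?case by simp
qed simp

lemma disjoint_grid_cells:
  fixes d :: real
  assumes "0 \<le> d" "i < j"
  shows "{d * real i<..d * real (Suc i)} \<inter> {d * real j<..d * real (Suc j)} = {}"
proof -
  have "d * real (Suc i) \<le> d * real j"
    using assms by (intro mult_left_mono) auto
  then show ?thesis by auto
qed

text \<open>\<open>U\<close> is a function of counts on cells up to time \<open>a\<close>, and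
  \<open>D\<close> is an event about counts on sets after \<open>a\<close>. All these sets are
  pairwise disjoint, so one joint independence statement can be split into two blocks.\<close>

lemma euler_indep_future:
  fixes d x :: real
  assumes "prob_space M" and N: "poisson_random_measure M N \<mu>" and s\<mu>: "sets \<mu> = sets borel"
    and f: "f \<in> borel_measurable borel" and g: "simple_function borel g"
    and d: "0 \<le> d" "d * real m \<le> a"
    and C: "C \<in> sets borel" "C' \<in> sets borel" "C \<inter> C' = {}" "C \<union> C' \<subseteq> {a<..} \<times> UNIV"
  defines "U \<equiv> \<lambda>\<omega>. euler f d (\<lambda>i. \<Sum>v\<in>range g. v * enn2real (emeasure (N \<omega>) ({d * i<..d * Suc i} \<times> g -` {v}))) x m"
    and "D \<equiv> {\<omega>\<in>space M. emeasure (N \<omega>) C = 1 \<and> emeasure (N \<omega>) C' = 0}"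
  shows "U \<in> borel_measurable M"
    and "B \<in> sets borel \<Longrightarrow> measure M (D \<inter> (U -` B \<inter> space M)) = measure M D * measure M (U -` B \<inter> space M)"
proof -
  interpret prob_space M by fact
  have fin: "finite (range g)" and gm: "\<And>v. g -` {v} \<in> sets borel"
    using simple_functionD[OF g] by auto
  \<comment> \<open>A sum type indexes past and future in one family: \<open>Inl (i, v)\<close> is
    the time cell \<open>i\<close> with the level set of \<open>v\<close>, and \<open>Inr\<close>
    selects one of the two future sets.\<close>
  define F where "F k = (case k of Inl (i, v) \<Rightarrow> {d * real i<..d * Suc i} \<times> g -` {v} | Inr b \<Rightarrow> if b then C else C')" for k
  define I :: "((nat \<times> real) + bool) set" where "I = Inl ` ({..<m} \<times> range g)"
  define J where "J = range (Inr :: bool \<Rightarrow> (nat \<times> real) + bool)"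
  have disj: "disjoint_family_on F (I \<union> J)"
  proof -
    have cell: "{d * real i<..d * Suc i} \<subseteq> {..a}" if "i < m" for i
    proof -
      have "d * real (Suc i) \<le> d * real m" using that d(1) by (intro mult_left_mono) auto
      with d(2) show ?thesis by auto
    qed
    have II: "F k \<inter> F l = {}" if kI: "k \<in> I" and lI: "l \<in> I" and ne: "k \<noteq> l" for k l
    proof -
      obtain i v j w where kl: "k = Inl (i, v)" "l = Inl (j, w)"
        using kI lI unfolding I_def by blast
      have "i < j \<or> j < i \<or> (i = j \<and> v \<noteq> w)"
        using ne kl by auto
      then consider "i < j" | "j < i" | "i = j" "v \<noteq> w" by blast
      then show ?thesis
        using disjoint_grid_cells[OF d(1), of i j] disjoint_grid_cells[OF d(1), of j i]
        by cases (auto simp: F_def kl)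
    qed
    have IJ: "F k \<inter> F l = {}" if kI: "k \<in> I" and lJ: "l \<in> J" for k l
    proof -
      obtain i v b where kl: "k = Inl (i, v)" "l = Inr b" "i < m"
        using kI lJ unfolding I_def J_def by blast
      have "F l \<subseteq> {a<..} \<times> UNIV" using C(4) by (auto simp: F_def kl)
      moreover have "F k \<subseteq> {..a} \<times> UNIV" using cell[OF kl(3)] by (auto simp: F_def kl)
      ultimately show ?thesis by fastforce
    qed
    have JJ: "F k \<inter> F l = {}" if "k \<in> J" "l \<in> J" "k \<noteq> l" for k l
      using that C(3) by (auto simp: F_def J_def split: if_splits)
    show ?thesis
      unfolding disjoint_family_on_def using II JJ IJ by (metis Int_commute Un_iff)
  qed
  have Fs: "F k \<in> sets borel" for k
    using C gm by (auto simp: F_def split: sum.split intro!: borel_Times)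
  let ?X = "\<lambda>k \<omega>. emeasure (N \<omega>) (F k)"
  have "countable (I \<union> J)"
    using fin by (intro countable_finite) (auto simp: I_def J_def)
  then have ind: "indep_vars (\<lambda>_. borel) ?X (I \<union> J)"
    by (rule poisson_random_measure_indep_vars[OF \<open>prob_space M\<close> N _ disj]) (simp add: s\<mu> Fs)
  define G where "G e = euler f d (\<lambda>i. \<Sum>v\<in>range g. v * enn2real (e (Inl (i, v)))) x m" for e :: "(nat \<times> real) + bool \<Rightarrow> ennreal"
  define H where "H e = (if e (Inr True) = 1 \<and> e (Inr False) = 0 then 1 else 0 :: real)" for e :: "(nat \<times> real) + bool \<Rightarrow> ennreal"
  have Gm: "G \<in> borel_measurable (PiM I (\<lambda>_. borel))"
    unfolding G_def
  proof (rule measurable_euler[OF f])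
    fix i assume i: "i < m"
    show "(\<lambda>e. \<Sum>v\<in>range g. v * enn2real (e (Inl (i, v)))) \<in> borel_measurable (PiM I (\<lambda>_. borel))"
      using i by (intro borel_measurable_sum borel_measurable_times borel_measurable_const
          measurable_compose[OF measurable_component_singleton borel_measurable_enn2real])
        (auto simp: I_def)
  qed
  have Hm: "H \<in> borel_measurable (PiM J (\<lambda>_. borel))"
  proof -
    have [measurable]: "(\<lambda>e. e (Inr b)) \<in> borel_measurable (PiM J (\<lambda>_. borel))" for b
      by (rule measurable_component_singleton) (auto simp: J_def)
    show ?thesis unfolding H_def by measurable
  qed
  have UG: "U \<omega> = G (restrict (\<lambda>k. ?X k \<omega>) I)" for \<omega>
    unfolding U_def G_def by (intro euler_cong sum.cong refl) (auto simp: I_def F_def)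
  have "indep_var (PiM I (\<lambda>_. borel)) (\<lambda>\<omega>. restrict (\<lambda>k. ?X k \<omega>) I) (PiM J (\<lambda>_. borel)) (\<lambda>\<omega>. restrict (\<lambda>k. ?X k \<omega>) J)"
    using ind by (rule indep_var_restrict) (auto simp: I_def J_def)
  from indep_var_compose[OF this Gm Hm]
  have iv: "indep_var borel U borel (\<lambda>\<omega>. H (restrict (\<lambda>k. ?X k \<omega>) J))"
    by (simp add: comp_def UG[symmetric])
  then show "U \<in> borel_measurable M"
    by (rule indep_var_rv1)
  have HD: "(\<lambda>\<omega>. H (restrict (\<lambda>k. ?X k \<omega>) J)) -` {1} \<inter> space M = D"
  proof -
    have "Inr b \<in> J" for b by (simp add: J_def)
    then show ?thesis by (auto simp: H_def D_def F_def split: if_splits)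
  qed
  assume B: "B \<in> sets borel"
  from indep_varD[OF iv B, of "{1}"]
  have "prob ((\<lambda>\<omega>. (U \<omega>, H (restrict (\<lambda>k. ?X k \<omega>) J))) -` (B \<times> {1}) \<inter> space M) =
    prob (U -` B \<inter> space M) * prob D"
    by (simp add: HD)
  also have "(\<lambda>\<omega>. (U \<omega>, H (restrict (\<lambda>k. ?X k \<omega>) J))) -` (B \<times> {1}) \<inter> space M = D \<inter> (U -` B \<inter> space M)"
    unfolding HD[symmetric] by auto
  finally show "prob (D \<inter> (U -` B \<inter> space M)) = prob D * prob (U -` B \<inter> space M)"
    by (simp only: mult.commute)
qed

section \<open>The law of a single jump\<close>

text \<open>On the event that \<open>R\<close> carries one point, the pair of \<open>V\<close> and
  that point has a product law, a multiple of law of \<open>V\<close> times \<open>\<mu>\<close> on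
  \<open>R\<close>. This is checked on rectangles, where a condition on the point becomes a
  condition on two counts. Fubini then reduces nullity of \<open>K\<close> to nullity of its
  sections.\<close>

lemma single_point_AE_notin:
  fixes V :: "'a \<Rightarrow> real" and W :: "'a \<Rightarrow> real \<times> real"
  assumes "prob_space M" and N: "poisson_random_measure M N \<mu>" and s\<mu>: "sets \<mu> = sets borel"
    and R: "R \<in> sets borel" "emeasure \<mu> R < \<infinity>"
    and V: "V \<in> borel_measurable M"
    and ind: "\<And>C C' A. C \<in> sets borel \<Longrightarrow> C' \<in> sets borel \<Longrightarrow> C \<inter> C' = {} \<Longrightarrow> C \<union> C' \<subseteq> R \<Longrightarrow> A \<in> sets borel \<Longrightarrow>
      measure M ({\<omega>\<in>space M. emeasure (N \<omega>) C = 1 \<and> emeasure (N \<omega>) C' = 0} \<inter> (V -` A \<inter> space M)) =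
      measure M {\<omega>\<in>space M. emeasure (N \<omega>) C = 1 \<and> emeasure (N \<omega>) C' = 0} * measure M (V -` A \<inter> space M)"
    and W: "\<And>\<omega> C. \<omega> \<in> space M \<Longrightarrow> emeasure (N \<omega>) R = 1 \<Longrightarrow> C \<in> sets borel \<Longrightarrow>
      emeasure (N \<omega>) (C \<inter> R) = indicator C (W \<omega>)"
    and K: "K \<in> sets (borel \<Otimes>\<^sub>M borel)" "\<And>z. emeasure \<mu> (Pair z -` K \<inter> R) = 0"
  shows "AE \<omega> in M. \<not> (emeasure (N \<omega>) R = 1 \<and> (V \<omega>, W \<omega>) \<in> K)"
proof -
  interpret prob_space M by fact
  have Nm [measurable]: "(\<lambda>\<omega>. emeasure (N \<omega>) C) \<in> borel_measurable M" if "C \<in> sets borel" for C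
    using poisson_random_measure_measurable[OF N] that s\<mu> by auto
  have sN: "sets (N \<omega>) = sets borel" if "\<omega> \<in> space M" for \<omega>
    using N that s\<mu> unfolding poisson_random_measure_def by auto
  note [measurable] = V R(1)
  define E where "E = {\<omega>\<in>space M. emeasure (N \<omega>) R = 1}"
  have E [measurable]: "E \<in> events" by (simp add: E_def)
  define D where "D C = {\<omega>\<in>space M. emeasure (N \<omega>) (C \<inter> R) = 1 \<and> emeasure (N \<omega>) (R - C) = 0}" for C
  have ED: "{\<omega>\<in>E. W \<omega> \<in> C} = D C" if C [measurable]: "C \<in> sets borel" for C
  proof (intro set_eqI iffI)
    fix \<omega> assume "\<omega> \<in> {\<omega>\<in>E. W \<omega> \<in> C}"
    then have \<omega>: "\<omega> \<in> space M" "emeasure (N \<omega>) R = 1" "W \<omega> \<in> C" by (auto simp: E_def)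
    moreover have "R - C = (- C) \<inter> R" by auto
    moreover have "- C \<in> sets borel" by measurable
    ultimately show "\<omega> \<in> D C"
      using W[OF \<omega>(1,2) C] W[OF \<omega>(1,2), of "- C"] by (simp add: D_def)
  next
    fix \<omega> assume "\<omega> \<in> D C"
    then have \<omega>: "\<omega> \<in> space M" "emeasure (N \<omega>) (C \<inter> R) = 1" "emeasure (N \<omega>) (R - C) = 0"
      by (auto simp: D_def)
    have "emeasure (N \<omega>) (C \<inter> R) + emeasure (N \<omega>) (R - C) = emeasure (N \<omega>) (C \<inter> R \<union> (R - C))"
      using C by (intro plus_emeasure) (auto simp: sN[OF \<omega>(1)])
    also have "C \<inter> R \<union> (R - C) = R" by auto
    finally have R1: "emeasure (N \<omega>) R = 1" using \<omega> by simp
    with W[OF \<omega>(1) R1 C] \<omega> show "\<omega> \<in> {\<omega>\<in>E. W \<omega> \<in> C}"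
      by (auto simp: E_def indicator_def split: if_splits)
  qed
  let ?ME = "restrict_space M E"
  have sE: "space ?ME = E" by (auto simp: space_restrict_space E_def)
  \<comment> \<open>\<open>W\<close> is constrained only on \<open>E\<close>, so measurability is
    claimed on the restricted space alone; it comes from the measurability of the counts.\<close>
  have Wm: "W \<in> borel_measurable ?ME"
  proof (rule measurableI)
    fix C :: "(real \<times> real) set" assume C: "C \<in> sets borel"
    have "W -` C \<inter> space ?ME = D C" unfolding sE ED[OF C, symmetric] by auto
    also have "D C \<in> sets ?ME"
    proof -
      have "D C \<in> events" using C unfolding D_def by measurable
      moreover have "D C \<subseteq> E" unfolding ED[OF C, symmetric] by auto
      ultimately show ?thesis
        using E by (simp add: sets_restrict_space_iff)
    qed
    finally show "W -` C \<inter> space ?ME \<in> sets ?ME" .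
  qed auto
  have Vm: "V \<in> borel_measurable ?ME"
    using V by (rule measurable_restrict_space1)
  have VW: "(\<lambda>\<omega>. (V \<omega>, W \<omega>)) \<in> ?ME \<rightarrow>\<^sub>M borel \<Otimes>\<^sub>M borel"
    using Vm Wm by measurable
  \<comment> \<open>For \<open>C \<subseteq> R\<close>, the product of \<open>c\<close> and the
    \<open>\<mu>\<close>-measure of \<open>C\<close> is the probability that \<open>R\<close> has a
    single point and that it lies in \<open>C\<close>. So \<open>\<rho>\<close> is the law of
    \<open>W\<close> on \<open>E\<close>, with total mass the probability of
    \<open>E\<close>.\<close>
  define c where "c = ennreal (exp (- measure \<mu> R))"
  define \<rho> where "\<rho> = density \<mu> (\<lambda>p. c * indicator R p)"
  have [measurable]: "indicator R \<in> borel_measurable \<mu>"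
    using R(1) by (intro borel_measurable_indicator) (simp add: s\<mu>)
  have \<rho>: "emeasure \<rho> C = c * emeasure \<mu> (C \<inter> R)" if "C \<in> sets borel" for C
  proof -
    have [measurable]: "C \<in> sets \<mu>" using that s\<mu> by simp
    have "emeasure \<rho> C = (\<integral>\<^sup>+p. c * indicator (C \<inter> R) p \<partial>\<mu>)"
      unfolding \<rho>_def by (subst emeasure_density) (auto intro!: nn_integral_cong split: split_indicator)
    also have "\<dots> = c * emeasure \<mu> (C \<inter> R)"
      using that R(1) by (intro nn_integral_cmult_indicator) (auto simp: s\<mu>)
    finally show ?thesis .
  qed
  have s\<rho>: "sets \<rho> = sets borel" by (simp add: \<rho>_def s\<mu>)
  have "finite_measure \<rho>"
  proof
    have "space \<rho> = UNIV" using sets_eq_imp_space_eq[OF s\<rho>] by simp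
    then have "emeasure \<rho> (space \<rho>) = c * emeasure \<mu> R" by (simp add: \<rho>)
    also have "\<dots> \<noteq> \<infinity>" using R(2) by (simp add: c_def ennreal_mult_eq_top_iff)
    finally show "emeasure \<rho> (space \<rho>) \<noteq> \<infinity>" .
  qed
  then interpret \<rho>: finite_measure \<rho> .
  interpret V: prob_space "distr M borel V"
    by (rule prob_space_distr) measurable
  have "distr M borel V \<Otimes>\<^sub>M \<rho> = distr ?ME (borel \<Otimes>\<^sub>M borel) (\<lambda>\<omega>. (V \<omega>, W \<omega>))"
  proof (rule pair_measure_eqI)
    show "sets (distr M borel V \<Otimes>\<^sub>M \<rho>) = sets (distr ?ME (borel \<Otimes>\<^sub>M borel) (\<lambda>\<omega>. (V \<omega>, W \<omega>)))"
      by (simp add: s\<rho> cong: sets_pair_measure_cong)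
    fix A C assume "A \<in> sets (distr M borel V)" "C \<in> sets \<rho>"
    then have A [measurable]: "A \<in> sets borel" and C [measurable]: "C \<in> sets borel" by (auto simp: s\<rho>)
    have fin: "emeasure \<mu> (C \<inter> R) < \<infinity>" "emeasure \<mu> (R - C) < \<infinity>"
      using R C by (auto intro: le_less_trans[OF emeasure_mono] simp: s\<mu>)
    have "measure \<mu> R = measure \<mu> (C \<inter> R) + measure \<mu> (R - C)"
    proof -
      have "measure \<mu> (C \<inter> R \<union> (R - C)) = measure \<mu> (C \<inter> R) + measure \<mu> (R - C)"
        using fin R C by (intro measure_Union) (auto simp: s\<mu>)
      moreover have "C \<inter> R \<union> (R - C) = R" by auto
      ultimately show ?thesis by simp
    qed
    then have PD: "prob (D C) = measure \<mu> (C \<inter> R) * exp (- measure \<mu> R)"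
      unfolding D_def using R C fin
      by (subst poisson_random_measure_single_point[OF \<open>prob_space M\<close> N]) (auto simp: s\<mu>)
    have "emeasure (distr ?ME (borel \<Otimes>\<^sub>M borel) (\<lambda>\<omega>. (V \<omega>, W \<omega>))) (A \<times> C) =
        emeasure ?ME ((\<lambda>\<omega>. (V \<omega>, W \<omega>)) -` (A \<times> C) \<inter> space ?ME)"
      by (rule emeasure_distr[OF VW]) auto
    also have "(\<lambda>\<omega>. (V \<omega>, W \<omega>)) -` (A \<times> C) \<inter> space ?ME = {\<omega>\<in>E. W \<omega> \<in> C} \<inter> (V -` A \<inter> space M)"
      by (auto simp: sE E_def)
    also have "\<dots> = D C \<inter> (V -` A \<inter> space M)"
      by (simp only: ED[OF C])
    also have "emeasure ?ME \<dots> = emeasure M (D C \<inter> (V -` A \<inter> space M))"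
      using E unfolding ED[OF C, symmetric] by (intro emeasure_restrict_space) auto
    also have "\<dots> = ennreal (prob (D C) * prob (V -` A \<inter> space M))"
      unfolding emeasure_eq_measure D_def using R C by (subst ind) auto
    also have "\<dots> = emeasure (distr M borel V) A * emeasure \<rho> C"
    proof -
      have "emeasure \<mu> (C \<inter> R) = ennreal (measure \<mu> (C \<inter> R))"
        using fin by (intro emeasure_eq_ennreal_measure) auto
      then show ?thesis
        by (simp add: PD \<rho> c_def emeasure_distr emeasure_eq_measure ennreal_mult[symmetric] mult_ac)
    qed
    finally show "emeasure (distr M borel V) A * emeasure \<rho> C =
      emeasure (distr ?ME (borel \<Otimes>\<^sub>M borel) (\<lambda>\<omega>. (V \<omega>, W \<omega>))) (A \<times> C)" by simp
  qed unfold_locales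
  moreover have "emeasure (distr M borel V \<Otimes>\<^sub>M \<rho>) K = 0"
  proof -
    have "sets (distr M borel V \<Otimes>\<^sub>M \<rho>) = sets (borel \<Otimes>\<^sub>M borel)"
      by (intro sets_pair_measure_cong) (simp_all add: s\<rho>)
    then have "emeasure (distr M borel V \<Otimes>\<^sub>M \<rho>) K = (\<integral>\<^sup>+z. emeasure \<rho> (Pair z -` K) \<partial>distr M borel V)"
      using K(1) by (intro \<rho>.emeasure_pair_measure_alt) simp
    also have "\<dots> = 0"
    proof -
      have "emeasure \<rho> (Pair z -` K) = 0" for z
        using K by (subst \<rho>) (auto intro: sets_Pair1)
      then show ?thesis by simp
    qed
    finally show ?thesis .
  qed
  ultimately have "emeasure ?ME ((\<lambda>\<omega>. (V \<omega>, W \<omega>)) -` K \<inter> space ?ME) = 0"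
    using emeasure_distr[OF VW K(1)] by simp
  then have "emeasure M ((\<lambda>\<omega>. (V \<omega>, W \<omega>)) -` K \<inter> E) = 0"
    using E by (simp add: sE emeasure_restrict_space)
  moreover have "(\<lambda>\<omega>. (V \<omega>, W \<omega>)) -` K \<inter> E \<in> events"
    using measurable_sets[OF VW K(1)] E by (simp add: sE sets_restrict_space_iff)
  ultimately have "(\<lambda>\<omega>. (V \<omega>, W \<omega>)) -` K \<inter> E \<in> null_sets M" by (rule null_setsI)
  then have "AE \<omega> in M. \<omega> \<notin> (\<lambda>\<omega>. (V \<omega>, W \<omega>)) -` K \<inter> E" by (rule AE_not_in)
  then show ?thesis
    using AE_space by eventually_elim (auto simp: E_def)
qed

section \<open>Null sets of the intensity\<close>

text \<open>Jumps of size zero are not counted. Hence finiteness of \<open>\<nu>\<close> off 0 is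
  finiteness outright, and \<open>h y \<noteq> 0\<close> holds for almost every mark.\<close>

lemma levy_measure_singleton_zero:
  assumes "levy_measure M X \<nu>"
  shows "emeasure \<nu> {0} = 0"
proof -
  have "emeasure (jump_measure y) ({0<..1} \<times> {0}) = 0" for y
  proof -
    have "{t. 0 < t \<and> jump y t \<noteq> 0 \<and> (t, jump y t) \<in> {0<..1} \<times> {0}} = {}" by auto
    moreover have "{0<..1::real} \<times> {0::real} \<in> sets borel" by (intro borel_Times) auto
    ultimately show ?thesis by (simp only: emeasure_jump_measure) simp
  qed
  then show ?thesis
    using assms unfolding levy_measure_def by simp
qed

context
  fixes \<nu> :: "real measure"
  assumes s\<nu>: "sets \<nu> = sets borel" and fin\<nu>: "finite_measure \<nu>"
begin

lemma sets_time_intensity: "sets (time_intensity \<nu>) = sets borel"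
  unfolding time_intensity_def borel_prod[symmetric] by (intro sets_pair_measure_cong) (simp_all add: s\<nu>)

lemma time_intensity_strip_finite: "emeasure (time_intensity \<nu>) ({0<..T} \<times> UNIV) < \<infinity>"
proof -
  interpret finite_measure \<nu> by (rule fin\<nu>)
  have "emeasure (time_intensity \<nu>) ({0<..T} \<times> UNIV) =
      emeasure (density lborel (indicator {0::real<..})) {0<..T} * emeasure \<nu> UNIV"
    unfolding time_intensity_def by (intro emeasure_pair_measure_Times) (auto simp: s\<nu>)
  also have "emeasure (density lborel (indicator {0::real<..})) {0<..T} = emeasure lborel {0<..T}"
  proof -
    have "emeasure (density lborel (indicator {0::real<..})) {0<..T} =
        (\<integral>\<^sup>+s. indicator {0::real<..} s * indicator {0<..T} s \<partial>lborel)"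
      by (rule emeasure_density) auto
    also have "\<dots> = (\<integral>\<^sup>+s. indicator {0<..T} s \<partial>lborel)"
      by (intro nn_integral_cong) (simp split: split_indicator)
    finally show ?thesis by simp
  qed
  also have "\<dots> * emeasure \<nu> UNIV < \<infinity>"
  proof -
    have "emeasure \<nu> UNIV < top"
      using emeasure_finite[of UNIV] less_top by blast
    then show ?thesis
      by (cases "0 \<le> T") (simp_all add: ennreal_mult_less_top)
  qed
  finally show ?thesis .
qed

text \<open>Tonelli with the mark outside and time inside, because the null set of jump times is
  controlled at a fixed mark. The time marginal is Lebesgue measure cut to positive times, so null
  sections stay null.\<close>

lemma time_intensity_null:
  assumes C: "C \<in> sets borel" and null: "AE y in \<nu>. {s. (s, y) \<in> C} \<in> null_sets lborel"
  shows "emeasure (time_intensity \<nu>) C = 0"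
proof -
  interpret finite_measure \<nu> by (rule fin\<nu>)
  interpret L: sigma_finite_measure "density lborel (indicator {0::real<..})"
    by (subst sigma_finite_measure.sigma_finite_iff_density_finite[OF sigma_finite_lborel])
      (auto intro!: borel_measurable_indicator split: split_indicator)
  interpret pair_sigma_finite "density lborel (indicator {0::real<..})" \<nu> ..
  have "emeasure (time_intensity \<nu>) C =
      (\<integral>\<^sup>+y. emeasure (density lborel (indicator {0::real<..})) ((\<lambda>s. (s, y)) -` C) \<partial>\<nu>)"
    using C unfolding time_intensity_def sets_time_intensity[symmetric]
    by (intro emeasure_pair_measure_alt2) (simp add: time_intensity_def)
  also have "\<dots> = (\<integral>\<^sup>+y. 0 \<partial>\<nu>)"
  proof (rule nn_integral_cong_AE, use null in eventually_elim)
    fix y assume "{s. (s, y) \<in> C} \<in> null_sets lborel"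
    then have "{s. (s, y) \<in> C} \<in> null_sets (density lborel (indicator {0::real<..}))"
      by (subst null_sets_density_iff) (auto dest: AE_not_in elim: eventually_mono)
    then show "emeasure (density lborel (indicator {0::real<..})) ((\<lambda>s. (s, y)) -` C) = 0"
      by (simp add: vimage_def null_setsD1)
  qed
  finally show ?thesis by simp
qed

end

section \<open>From the jump measure to paths\<close>

lemma jump_measure_single:
  assumes "emeasure (jump_measure y) ({a<..T} \<times> (-{0})) = 1" and a: "0 \<le> a"
  obtains \<tau> where "{t. 0 < t \<and> t \<le> T \<and> jump y t \<noteq> 0} \<inter> {a<..T} = {\<tau>}"
    and "\<And>C. C \<in> sets borel \<Longrightarrow>
      emeasure (jump_measure y) (C \<inter> ({a<..T} \<times> (-{0}))) = indicator C (\<tau>, jump y \<tau>)"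
proof -
  let ?R = "{a<..T} \<times> (-{0::real})"
  have R: "?R \<in> sets borel" by (intro borel_Times) auto
  define J where "J = {t. 0 < t \<and> jump y t \<noteq> 0 \<and> (t, jump y t) \<in> ?R}"
  have "(if finite J then of_nat (card J) else \<infinity>) = (1 :: ennreal)"
    using assms(1) unfolding emeasure_jump_measure[OF R] Let_def J_def[symmetric] .
  then have "card J = 1"
    by (auto split: if_splits)
  then obtain \<tau> where \<tau>: "J = {\<tau>}" by (rule card_1_singletonE)
  have "{t. 0 < t \<and> t \<le> T \<and> jump y t \<noteq> 0} \<inter> {a<..T} = J"
    using a by (auto simp: J_def)
  moreover have "emeasure (jump_measure y) (C \<inter> ?R) = indicator C (\<tau>, jump y \<tau>)"
    if C: "C \<in> sets borel" for C
  proof -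
    have "{t. 0 < t \<and> jump y t \<noteq> 0 \<and> (t, jump y t) \<in> C \<inter> ?R} = {t\<in>J. (t, jump y t) \<in> C}"
      by (auto simp: J_def)
    also have "\<dots> = (if (\<tau>, jump y \<tau>) \<in> C then {\<tau>} else {})"
      by (auto simp: \<tau>)
    finally show ?thesis
      using C R by (subst emeasure_jump_measure) (auto simp: Let_def)
  qed
  ultimately show ?thesis using \<tau> that by blast
qed

text \<open>Grouping the jumps by the value of \<open>g\<close> links the scheme built from counts,
  for which independence is available, with the pathwise scheme, for which convergence is
  available.\<close>

lemma jump_measure_simple_sum:
  assumes S: "S = {t. 0 < t \<and> t \<le> T \<and> jump y t \<noteq> 0}" and fin: "finite S"
    and g: "simple_function borel g" and pq: "0 \<le> p" "q \<le> T"
  shows "(\<Sum>v\<in>range g. v * enn2real (emeasure (jump_measure y) ({p<..q} \<times> g -` {v}))) =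
    (\<Sum>s\<in>S \<inter> {p<..q}. g (jump y s) :: real)"
proof -
  let ?S = "S \<inter> {p<..q}"
  have card: "enn2real (emeasure (jump_measure y) ({p<..q} \<times> g -` {v})) = card {s\<in>?S. g (jump y s) = v}" for v
  proof -
    have "{t. 0 < t \<and> jump y t \<noteq> 0 \<and> (t, jump y t) \<in> {p<..q} \<times> g -` {v}} = {s\<in>?S. g (jump y s) = v}"
      using pq by (auto simp: S)
    moreover have "{p<..q} \<times> g -` {v} \<in> sets borel"
      using simple_functionD(2)[OF g, of "{v}"] by (intro borel_Times) auto
    moreover have "finite {s\<in>?S. g (jump y s) = v}"
      using fin by simp
    ultimately show ?thesis
      by (simp add: emeasure_jump_measure Let_def)
  qed
  have "(\<Sum>v\<in>range g. v * enn2real (emeasure (jump_measure y) ({p<..q} \<times> g -` {v}))) =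
    (\<Sum>v\<in>range g. \<Sum>s | s \<in> ?S \<and> g (jump y s) = v. g (jump y s))"
    unfolding card by (intro sum.cong refl) (simp add: mult.commute)
  also have "\<dots> = (\<Sum>s\<in>?S. g (jump y s))"
    using fin simple_functionD(1)[OF g] by (intro sum.group) auto
  finally show ?thesis .
qed

lemma (in lipschitz_flow) jump_sde_jump_path:
  assumes Z: "cadlag_on {0..T} Z"
    and sde: "\<forall>t\<in>{0..T}. Z t = x + (LINT s:{0..t}|lborel. f (Z s))
      + (LINT p:{0..t} \<times> (-{0})|jump_measure y. h (snd p))"
    and h: "h \<in> borel_measurable borel"
    and S: "S = {t. 0 < t \<and> t \<le> T \<and> jump y t \<noteq> 0}" and fin: "finite S"
  shows "jump_path f S (\<lambda>s. h (jump y s)) x T Z" and "\<exists>K. \<forall>t\<in>{0..T}. \<bar>f (Z t)\<bar> \<le> K"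
proof -
  note int = cadlag_on_set_integrable[OF Z continuous_on_rhs]
  show "jump_path f S (\<lambda>s. h (jump y s)) x T Z"
    unfolding jump_path_def
  proof (intro conjI ballI)
    show "(\<lambda>s. f (Z s)) integrable_on {0..T}"
      by (rule set_borel_integral_eq_integral(1)[OF int[OF order_refl]])
    fix t assume t: "t \<in> {0..T}"
    then have "t \<le> T" by simp
    note sde[rule_format, OF t]
    also have "(LINT s:{0..t}|lborel. f (Z s)) = integral {0..t} (\<lambda>s. f (Z s))"
      by (rule set_borel_integral_eq_integral(2)[OF int[OF \<open>t \<le> T\<close>]])
    also have "(LINT p:{0..t} \<times> (-{0})|jump_measure y. h (snd p)) = (\<Sum>s\<in>S \<inter> {0<..t}. h (jump y s))"
      by (rule integral_jump_measure_Icc[OF h fin S \<open>t \<le> T\<close>])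
    finally show "Z t = x + integral {0..t} (\<lambda>s. f (Z s)) + (\<Sum>s\<in>S \<inter> {0<..t}. h (jump y s))" .
  qed
  obtain K where K: "\<And>t. t \<in> {0..T} \<Longrightarrow> \<bar>Z t\<bar> \<le> K"
    using cadlag_on_bounded[OF Z] by blast
  have "\<bar>f (Z t)\<bar> \<le> \<bar>f 0\<bar> + L * K" if "t \<in> {0..T}" for t
  proof -
    have "\<bar>f (Z t) - f 0\<bar> \<le> L * \<bar>Z t - 0\<bar>" by (rule lip_bound)
    also have "\<dots> \<le> L * K" using K[OF that] lip_nonneg by (simp add: mult_left_mono)
    finally show ?thesis by linarith
  qed
  then show "\<exists>K. \<forall>t\<in>{0..T}. \<bar>f (Z t)\<bar> \<le> K" by blast
qed

lemma (in lipschitz_flow) jump_path_indep_future: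
  fixes y :: "'a \<Rightarrow> real \<Rightarrow> real" and Z :: "real \<Rightarrow> 'a \<Rightarrow> real"
  assumes "prob_space M" and N: "poisson_random_measure M N \<mu>" and s\<mu>: "sets \<mu> = sets borel"
    and Ny: "\<And>\<omega>. N \<omega> = jump_measure (y \<omega>)"
    and h: "h \<in> borel_measurable borel" and a: "0 \<le> a" "a \<le> T" and Za: "Z a \<in> borel_measurable M"
    and path: "AE \<omega> in M. finite (S \<omega>) \<and> jump_path f (S \<omega>) (\<lambda>s. h (jump (y \<omega>) s)) x T (\<lambda>t. Z t \<omega>)
      \<and> (\<exists>K. \<forall>t\<in>{0..T}. \<bar>f (Z t \<omega>)\<bar> \<le> K)"
    and S: "\<And>\<omega>. S \<omega> = {t. 0 < t \<and> t \<le> T \<and> jump (y \<omega>) t \<noteq> 0}"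
    and C: "C \<in> sets borel" "C' \<in> sets borel" "C \<inter> C' = {}" "C \<union> C' \<subseteq> {a<..} \<times> UNIV"
    and A: "A \<in> sets borel"
  defines "D \<equiv> {\<omega>\<in>space M. emeasure (N \<omega>) C = 1 \<and> emeasure (N \<omega>) C' = 0}"
  shows "measure M (D \<inter> (Z a -` A \<inter> space M)) = measure M D * measure M (Z a -` A \<inter> space M)"
proof -
  interpret prob_space M by fact
  have fm: "f \<in> borel_measurable borel"
    by (rule borel_measurable_continuous_onI[OF continuous_on_rhs])
  \<comment> \<open>Pointwise convergence suffices, since almost every path has only finitely many
    jumps up to \<open>T\<close>.\<close>
  obtain g where g: "\<And>n. simple_function borel (g n)" and g_lim: "\<And>v. (\<lambda>n. g n v) \<longlonglongrightarrow> h v"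
    using borel_measurable_implies_sequence_metric[OF h, of 0] by auto
  define d where "d n = a / real (Suc n)" for n
  have d: "0 \<le> d n" "d n * real (Suc n) \<le> a" for n
    using a by (auto simp: d_def)
  define U where "U n \<omega> = euler f (d n)
    (\<lambda>i. \<Sum>v\<in>range (g n). v * enn2real (emeasure (N \<omega>) ({d n * i<..d n * Suc i} \<times> g n -` {v}))) x (Suc n)" for n \<omega>
  have Um: "U n \<in> borel_measurable M" for n
    unfolding U_def by (rule euler_indep_future(1)[OF \<open>prob_space M\<close> N s\<mu> fm g d C])
  have Uind: "prob (D \<inter> (U n -` A \<inter> space M)) = prob D * prob (U n -` A \<inter> space M)"
    if "A \<in> sets borel" for n A
    unfolding U_def D_def using that by (rule euler_indep_future(2)[OF \<open>prob_space M\<close> N s\<mu> fm g d C])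
  have lim: "AE \<omega> in M. (\<lambda>n. U n \<omega>) \<longlonglongrightarrow> Z a \<omega>"
    using path
  proof eventually_elim
    fix \<omega> assume \<omega>: "finite (S \<omega>) \<and> jump_path f (S \<omega>) (\<lambda>s. h (jump (y \<omega>) s)) x T (\<lambda>t. Z t \<omega>)
      \<and> (\<exists>K. \<forall>t\<in>{0..T}. \<bar>f (Z t \<omega>)\<bar> \<le> K)"
    then obtain K where K: "\<And>t. t \<in> {0..T} \<Longrightarrow> \<bar>f (Z t \<omega>)\<bar> \<le> K" by blast
    from \<omega> have fin: "finite (S \<omega>)"
      and jp: "jump_path f (S \<omega>) (\<lambda>s. h (jump (y \<omega>) s)) x T (\<lambda>t. Z t \<omega>)" by blast+
    have "U n \<omega> = euler f (d n) (\<lambda>i. \<Sum>s\<in>S \<omega> \<inter> {d n * i<..d n * Suc i}. g n (jump (y \<omega>) s)) x (Suc n)" for n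
      unfolding U_def
    proof (rule euler_cong)
      fix i assume "i < Suc n"
      then have "d n * real (Suc i) \<le> d n * real (Suc n)"
        using d by (intro mult_left_mono) auto
      then have "d n * real (Suc i) \<le> T" using d(2)[of n] a by linarith
      moreover have "0 \<le> d n * real i" using d by simp
      ultimately show "(\<Sum>v\<in>range (g n). v * enn2real (emeasure (N \<omega>) ({d n * i<..d n * Suc i} \<times> g n -` {v}))) =
          (\<Sum>s\<in>S \<omega> \<inter> {d n * i<..d n * Suc i}. g n (jump (y \<omega>) s))"
        unfolding Ny using jump_measure_simple_sum[OF S fin g] by blast
    qed
    moreover have "(\<lambda>n. euler f (d n) (\<lambda>i. \<Sum>s\<in>S \<omega> \<inter> {d n * i<..d n * Suc i}. g n (jump (y \<omega>) s)) x (Suc n))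
        \<longlonglongrightarrow> Z a \<omega>"
      using a by (intro euler_tendsto[OF jump_path_mono[OF jp] fin _ K] g_lim) (auto simp: d_def)
    ultimately show "(\<lambda>n. U n \<omega>) \<longlonglongrightarrow> Z a \<omega>" by simp
  qed
  have "(\<lambda>\<omega>. emeasure (N \<omega>) C) \<in> borel_measurable M" "(\<lambda>\<omega>. emeasure (N \<omega>) C') \<in> borel_measurable M"
    using C by (auto intro!: poisson_random_measure_measurable[OF N] simp: s\<mu>)
  then have D: "D \<in> events"
    unfolding D_def by measurable
  show ?thesis
    by (rule indep_event_limit[OF D Um Za lim Uind A])
qed

text \<open>Negligibility gives a null set of the completed measure only; Borel measurability of
  \<open>Q\<close> brings it back to \<open>lborel\<close>.\<close>

lemma (in lipschitz_flow) jump_times_null_set: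
  assumes inj: "inj f" and B: "B \<in> null_sets lborel" and k: "k \<noteq> 0"
    and m: "Q \<in> sets borel"
    and Q: "\<And>s. s \<in> Q \<Longrightarrow> s \<in> {a..T} \<and> \<phi> (T - s) (\<phi> (s - a) z + k) \<in> B"
  shows "Q \<in> null_sets lborel"
proof -
  have "negligible B"
    using B by (simp add: negligible_iff_null_sets null_sets_completionI)
  from negligible_jump_times[OF inj k this] have "negligible Q"
    by (rule negligible_subset) (use Q in auto)
  then show ?thesis
    using m by (simp add: negligible_iff_null_sets null_sets_completion_iff)
qed

section \<open>Absolute continuity of the terminal value\<close>

theorem theorem5p4:
  fixes M :: "'a measure" and X Z :: "real \<Rightarrow> 'a \<Rightarrow> real"
    and N :: "'a \<Rightarrow> (real \<times> real) measure" and \<nu> :: "real measure"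
    and T x :: real and f h :: "real \<Rightarrow> real"
  assumes "0 < T"
    and "complete_measure M"
    and "levy_process M X"
    and "\<And>\<omega>. N \<omega> = jump_measure (\<lambda>t. X t \<omega>)"
    and "levy_measure M X \<nu>"
    and "poisson_random_measure M N (time_intensity \<nu>)"
    and "emeasure \<nu> (-{0}) < \<infinity>"
    and "strict_mono f \<or> strict_antimono_on UNIV f"
    and "\<And>u. f differentiable (at u)"
    and "bounded (range (deriv f))"
    and "h \<in> borel_measurable \<nu>"
    and "integrable \<nu> (\<lambda>y. (h y)\<^sup>2)"
    and "\<And>y. y \<noteq> 0 \<Longrightarrow> h y \<noteq> 0"
    and "jump_sde_solution M N T x f h Z"
  shows "\<forall>B\<in>sets borel. emeasure lborel B = 0 \<longrightarrow>
           {\<omega> \<in> space M. Z T \<omega> \<in> B \<and> 1 \<le> emeasure (N \<omega>) ({0..T} \<times> (-{0}))} \<in> null_sets M"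
proof (intro ballI impI)
  fix B :: "real set" assume B [measurable]: "B \<in> sets borel" and B0: "emeasure lborel B = 0"
  have Bnull: "B \<in> null_sets lborel" using B B0 by (intro null_setsI) auto
  have "prob_space M" using assms(3) by (simp add: levy_process_def)
  interpret prob_space M by fact
  note Nd = assms(4) and prm = assms(6)
  have s\<nu>: "sets \<nu> = sets borel" using assms(5) by (simp add: levy_measure_def)
  have \<nu>0: "emeasure \<nu> {0} = 0" by (rule levy_measure_singleton_zero[OF assms(5)])
  have fin\<nu>: "finite_measure \<nu>"
  proof
    have "emeasure \<nu> (space \<nu>) = emeasure \<nu> ({0} \<union> -{0})"
      using sets_eq_imp_space_eq[OF s\<nu>] by simp
    also have "\<dots> = emeasure \<nu> {0} + emeasure \<nu> (-{0})"
      by (intro plus_emeasure[symmetric]) (auto simp: s\<nu>)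
    finally show "emeasure \<nu> (space \<nu>) \<noteq> \<infinity>" using assms(7) \<nu>0 by simp
  qed
  note sI = sets_time_intensity[OF s\<nu> fin\<nu>]
  note strip = time_intensity_strip_finite[OF s\<nu> fin\<nu>]
  have h: "h \<in> borel_measurable borel"
    using assms(11) by (simp add: measurable_cong_sets[OF s\<nu> refl])
  have inj: "inj f"
    using assms(8)
  proof
    assume "strict_mono f" then show ?thesis by (rule strict_mono_imp_inj_on)
  next
    assume "strict_antimono_on UNIV f"
    then have "f v < f u" if "u < v" for u v using that by (auto simp: monotone_on_def)
    then show ?thesis by (metis injI linorder_neqE less_irrefl)
  qed
  obtain L where lipf: "L-lipschitz_on UNIV f"
    using differentiable_bounded_deriv_lipschitz[OF assms(9,10)] by blast
  obtain \<phi> where "lipschitz_flow f L \<phi>" using lipschitz_flow_exists[OF lipf] by blast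
  then interpret lipschitz_flow f L \<phi> .
  have Zm: "Z t \<in> borel_measurable M" if "t \<in> {0..T}" for t
    using assms(14) that unfolding jump_sde_solution_def by blast
  have Zc: "AE \<omega> in M. cadlag_on {0..T} (\<lambda>t. Z t \<omega>)"
    and Zs: "AE \<omega> in M. \<forall>t\<in>{0..T}. Z t \<omega> = x + (LINT s:{0..t}|lborel. f (Z s \<omega>))
                  + (LINT p:{0..t} \<times> (-{0})|N \<omega>. h (snd p))"
    using assms(14) unfolding jump_sde_solution_def by blast+
  define S where "S \<omega> = {t. 0 < t \<and> t \<le> T \<and> jump (\<lambda>t. X t \<omega>) t \<noteq> 0}" for \<omega>
  have strip_sets: "{0<..T} \<times> (UNIV :: real set) \<in> sets borel"
    by (intro borel_Times) auto
  have "AE \<omega> in M. \<exists>n::nat. emeasure (N \<omega>) ({0<..T} \<times> UNIV) = of_nat n"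
    using strip strip_sets by (intro poisson_random_measure_AE_finite[OF \<open>prob_space M\<close> prm]) (auto simp: sI)
  then have path: "AE \<omega> in M. finite (S \<omega>) \<and>
      jump_path f (S \<omega>) (\<lambda>s. h (jump (\<lambda>t. X t \<omega>) s)) x T (\<lambda>t. Z t \<omega>) \<and>
      (\<exists>K. \<forall>t\<in>{0..T}. \<bar>f (Z t \<omega>)\<bar> \<le> K)"
    using Zc Zs
  proof eventually_elim
    case (elim \<omega>)
    have "{t. 0 < t \<and> jump (\<lambda>t. X t \<omega>) t \<noteq> 0 \<and> (t, jump (\<lambda>t. X t \<omega>) t) \<in> {0<..T} \<times> UNIV} = S \<omega>"
      by (auto simp: S_def)
    with elim(1) have fin: "finite (S \<omega>)"
      unfolding Nd emeasure_jump_measure[OF strip_sets] by (auto simp: Let_def split: if_splits)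
    from jump_sde_jump_path[OF elim(2) elim(3)[unfolded Nd] h S_def fin] fin
    show ?case by blast
  qed
  \<comment> \<open>\<open>THE\<close> names a jump time only when \<open>{a<..T}\<close> contains
    exactly one jump; elsewhere the value of \<open>W a\<close> is arbitrary.\<close>
  define W where "W a \<omega> = (let \<tau> = (THE \<tau>. S \<omega> \<inter> {a<..T} = {\<tau>}) in (\<tau>, jump (\<lambda>t. X t \<omega>) \<tau>))" for a \<omega>
  define R where "R a = {a<..T} \<times> (-{0::real})" for a
  have Rm [measurable]: "R a \<in> sets borel" for a
    unfolding R_def by (intro borel_Times) auto
  \<comment> \<open>Clamping the time extends the flow continuously to the whole plane, so that
    \<open>F\<close> is Borel everywhere; for jump times in \<open>{a<..T}\<close> both time
    arguments are nonnegative and the clamp has no effect.\<close>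
  define \<phi>' where "\<phi>' t z = \<phi> (max 0 t) z" for t z
  have "continuous_on UNIV (\<lambda>p. \<phi>' (fst p) (snd p))"
    unfolding \<phi>'_def by (intro continuous_intros) auto
  then have "(\<lambda>p. \<phi>' (fst p) (snd p)) \<in> borel_measurable borel"
    by (rule borel_measurable_continuous_onI)
  then have \<phi>'m: "(\<lambda>p. \<phi>' (fst p) (snd p)) \<in> borel_measurable (borel \<Otimes>\<^sub>M borel)"
    by (simp only: borel_prod)
  define F where "F a z p = \<phi>' (T - fst p) (\<phi>' (fst p - a) z + h (snd p))" for a z p
  have Fm: "(\<lambda>q. F a (fst q) (snd q)) \<in> borel_measurable (borel \<Otimes>\<^sub>M (borel \<Otimes>\<^sub>M borel))" for a
  proof -
    note [measurable] = h
    have comp: "(\<lambda>q. \<phi>' (u q) (w q)) \<in> borel_measurable (borel \<Otimes>\<^sub>M (borel \<Otimes>\<^sub>M borel))"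
      if "u \<in> borel_measurable (borel \<Otimes>\<^sub>M (borel \<Otimes>\<^sub>M borel))" "w \<in> borel_measurable (borel \<Otimes>\<^sub>M (borel \<Otimes>\<^sub>M borel))"
      for u w :: "real \<times> real \<times> real \<Rightarrow> real"
      using measurable_compose[OF measurable_Pair[OF that] \<phi>'m] by simp
    have 1: "(\<lambda>q :: real \<times> real \<times> real. \<phi>' (fst (snd q) - a) (fst q)) \<in> borel_measurable (borel \<Otimes>\<^sub>M (borel \<Otimes>\<^sub>M borel))"
      by (rule comp[of "\<lambda>q. fst (snd q) - a" fst]) measurable
    have "(\<lambda>q :: real \<times> real \<times> real. h (snd (snd q))) \<in> borel_measurable (borel \<Otimes>\<^sub>M (borel \<Otimes>\<^sub>M borel))"
      by measurable
    with 1 have "(\<lambda>q. \<phi>' (fst (snd q) - a) (fst q) + h (snd (snd q))) \<in> borel_measurable (borel \<Otimes>\<^sub>M (borel \<Otimes>\<^sub>M borel))"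
      by (rule borel_measurable_add)
    then show ?thesis
      unfolding F_def by (rule comp[rotated]) measurable
  qed
  \<comment> \<open>The states at time \<open>a\<close>, paired with a jump, from which that jump as
    the only one in \<open>{a<..T}\<close> leads into \<open>B\<close> at time
    \<open>T\<close>.\<close>
  define K where "K a = {q. F a (fst q) (snd q) \<in> B}" for a
  have Km: "K a \<in> sets (borel \<Otimes>\<^sub>M borel)" for a
  proof -
    have "K a = (\<lambda>q. F a (fst q) (snd q)) -` B \<inter> space (borel \<Otimes>\<^sub>M (borel \<Otimes>\<^sub>M borel))"
      by (auto simp: K_def space_pair_measure)
    also have "\<dots> \<in> sets (borel \<Otimes>\<^sub>M (borel \<Otimes>\<^sub>M borel))"
      by (rule measurable_sets[OF Fm B])
    finally show ?thesis by (simp only: borel_prod)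
  qed
  have single: "S \<omega> \<inter> {a<..T} = {fst (W a \<omega>)}" "W a \<omega> = (fst (W a \<omega>), jump (\<lambda>t. X t \<omega>) (fst (W a \<omega>)))"
    "\<And>C. C \<in> sets borel \<Longrightarrow> emeasure (N \<omega>) (C \<inter> R a) = indicator C (W a \<omega>)"
    if one: "emeasure (N \<omega>) (R a) = 1" and a: "0 \<le> a" for a \<omega>
  proof -
    obtain \<tau> where \<tau>: "S \<omega> \<inter> {a<..T} = {\<tau>}"
      and C: "\<And>C. C \<in> sets borel \<Longrightarrow> emeasure (N \<omega>) (C \<inter> R a) = indicator C (\<tau>, jump (\<lambda>t. X t \<omega>) \<tau>)"
      using jump_measure_single[OF one[unfolded Nd R_def] a] unfolding Nd R_def S_def by blast
    have "(THE \<tau>'. S \<omega> \<inter> {a<..T} = {\<tau>'}) = \<tau>" unfolding \<tau> by auto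
    then have W: "W a \<omega> = (\<tau>, jump (\<lambda>t. X t \<omega>) \<tau>)" by (simp add: W_def)
    show "S \<omega> \<inter> {a<..T} = {fst (W a \<omega>)}" "W a \<omega> = (fst (W a \<omega>), jump (\<lambda>t. X t \<omega>) (fst (W a \<omega>)))"
      by (simp_all add: W \<tau>)
    show "emeasure (N \<omega>) (C \<inter> R a) = indicator C (W a \<omega>)" if "C \<in> sets borel" for C
      using C[OF that] by (simp add: W)
  qed
  have one_jump: "AE \<omega> in M. \<not> (emeasure (N \<omega>) (R a) = 1 \<and> (Z a \<omega>, W a \<omega>) \<in> K a)"
    if a: "0 \<le> a" "a \<le> T" for a
  proof (rule single_point_AE_notin[OF \<open>prob_space M\<close> prm sI Rm])
    have "emeasure (time_intensity \<nu>) (R a) \<le> emeasure (time_intensity \<nu>) ({0<..T} \<times> UNIV)"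
      using a strip_sets by (intro emeasure_mono) (auto simp: R_def sI)
    then show "emeasure (time_intensity \<nu>) (R a) < \<infinity>" using strip by (rule le_less_trans)
    show Za: "Z a \<in> borel_measurable M" using a by (intro Zm) auto
    show "K a \<in> sets (borel \<Otimes>\<^sub>M borel)" by (rule Km)
    show "emeasure (N \<omega>) (C \<inter> R a) = indicator C (W a \<omega>)"
      if "\<omega> \<in> space M" "emeasure (N \<omega>) (R a) = 1" "C \<in> sets borel" for \<omega> C
      using that a by (intro single(3))
    show "prob ({\<omega>\<in>space M. emeasure (N \<omega>) C = 1 \<and> emeasure (N \<omega>) C' = 0} \<inter> (Z a -` A \<inter> space M)) =
      prob {\<omega>\<in>space M. emeasure (N \<omega>) C = 1 \<and> emeasure (N \<omega>) C' = 0} * prob (Z a -` A \<inter> space M)"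
      if "C \<in> sets borel" "C' \<in> sets borel" "C \<inter> C' = {}" "C \<union> C' \<subseteq> R a" "A \<in> sets borel" for C C' A
    proof (rule jump_path_indep_future[OF \<open>prob_space M\<close> prm sI Nd h a Za path S_def that(1,2,3) _ that(5)])
      show "C \<union> C' \<subseteq> {a<..} \<times> UNIV" using that(4) by (auto simp: R_def)
    qed
    show "emeasure (time_intensity \<nu>) (Pair z -` K a \<inter> R a) = 0" for z
    proof (rule time_intensity_null[OF s\<nu> fin\<nu>])
      show Q: "Pair z -` K a \<inter> R a \<in> sets borel"
        using Km[of a] by (intro sets.Int Rm) (auto intro: sets_Pair1)
      have "{0} \<in> null_sets \<nu>" using \<nu>0 by (intro null_setsI) (auto simp: s\<nu>)
      then have "AE y in \<nu>. y \<notin> {0}" by (rule AE_not_in)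
      then show "AE y in \<nu>. {s. (s, y) \<in> Pair z -` K a \<inter> R a} \<in> null_sets lborel"
      proof eventually_elim
        fix y :: real assume y: "y \<notin> {0}"
        show "{s. (s, y) \<in> Pair z -` K a \<inter> R a} \<in> null_sets lborel"
        proof (rule jump_times_null_set[OF inj Bnull])
          show "h y \<noteq> 0" using y assms(13) by simp
          have "Pair z -` K a \<inter> R a \<in> sets (borel \<Otimes>\<^sub>M borel)" using Q by (simp only: borel_prod)
          then have "(\<lambda>s. (s, y)) -` (Pair z -` K a \<inter> R a) \<in> sets borel" by (rule sets_Pair2)
          then show "{s. (s, y) \<in> Pair z -` K a \<inter> R a} \<in> sets borel" by (simp add: vimage_def)
          show "s \<in> {a..T} \<and> \<phi> (T - s) (\<phi> (s - a) z + h y) \<in> B"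
            if "s \<in> {s. (s, y) \<in> Pair z -` K a \<inter> R a}" for s
            using that by (auto simp: R_def K_def F_def \<phi>'_def max_def split: if_splits)
        qed
      qed
    qed
  qed
  \<comment> \<open>The suitable cut depends on the path, so a single exceptional null set has to
    serve all cuts at once; this is why they are drawn from a countable dense set.\<close>
  have "AE \<omega> in M. \<forall>r\<in>{r\<in>\<rat>. 0 \<le> r \<and> r \<le> T}. \<not> (emeasure (N \<omega>) (R r) = 1 \<and> (Z r \<omega>, W r \<omega>) \<in> K r)"
  proof (subst AE_ball_countable)
    show "countable {r\<in>\<rat>. 0 \<le> r \<and> r \<le> T}"
      by (rule countable_subset[OF _ countable_rat]) auto
  qed (use one_jump in blast)
  then have "AE \<omega> in M. \<not> (Z T \<omega> \<in> B \<and> 1 \<le> emeasure (N \<omega>) ({0..T} \<times> (-{0})))"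
    using path
  proof eventually_elim
    case (elim \<omega>)
    then have fin: "finite (S \<omega>)"
      and jp: "jump_path f (S \<omega>) (\<lambda>s. h (jump (\<lambda>t. X t \<omega>) s)) x T (\<lambda>t. Z t \<omega>)" by blast+
    show ?case
    proof
      assume H: "Z T \<omega> \<in> B \<and> 1 \<le> emeasure (N \<omega>) ({0..T} \<times> (-{0}))"
      have "S \<omega> \<noteq> {}"
      proof
        assume e: "S \<omega> = {}"
        have "{0..T} \<times> (-{0::real}) \<in> sets borel" by (intro borel_Times) auto
        moreover have "{t. 0 < t \<and> jump (\<lambda>t. X t \<omega>) t \<noteq> 0 \<and> (t, jump (\<lambda>t. X t \<omega>) t) \<in> {0..T} \<times> (-{0})} = S \<omega>"
          by (auto simp: S_def)
        ultimately have "emeasure (N \<omega>) ({0..T} \<times> (-{0})) = 0"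
          by (simp only: Nd emeasure_jump_measure e) simp
        with H show False by simp
      qed
      define \<tau> where "\<tau> = Max (S \<omega>)"
      have \<tau>: "\<tau> \<in> S \<omega>" "\<And>s. s \<in> S \<omega> \<Longrightarrow> s \<le> \<tau>"
        using fin \<open>S \<omega> \<noteq> {}\<close> by (auto simp: \<tau>_def)
      \<comment> \<open>The last jump but one, or 0 if there is none. A rational cut strictly
        between \<open>b\<close> and \<open>\<tau>\<close> is then nonnegative and leaves
        \<open>\<tau>\<close> as the only later jump.\<close>
      define b where "b = Max (insert 0 (S \<omega> - {\<tau>}))"
      have b: "0 \<le> b" "\<And>s. s \<in> S \<omega> \<Longrightarrow> s \<noteq> \<tau> \<Longrightarrow> s \<le> b"
        using fin by (auto simp: b_def)
      have "b \<in> insert 0 (S \<omega> - {\<tau>})"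
        unfolding b_def using fin by (intro Max_in) auto
      then have "b < \<tau>" using \<tau> by (force simp: S_def)
      from Rats_dense_in_real[OF this] obtain r where r: "r \<in> \<rat>" "b < r" "r < \<tau>" by blast
      have "\<tau> \<le> T" using \<tau>(1) by (simp add: S_def)
      with r b(1) have rT: "0 \<le> r" "r \<le> T" by auto
      have Sr: "{t. 0 < t \<and> jump (\<lambda>t. X t \<omega>) t \<noteq> 0 \<and> (t, jump (\<lambda>t. X t \<omega>) t) \<in> R r} = {\<tau>}"
      proof (intro equalityI subsetI)
        fix t assume "t \<in> {t. 0 < t \<and> jump (\<lambda>t. X t \<omega>) t \<noteq> 0 \<and> (t, jump (\<lambda>t. X t \<omega>) t) \<in> R r}"
        then have "t \<in> S \<omega>" "r < t" by (auto simp: S_def R_def)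
        with b(2)[of t] r(2) show "t \<in> {\<tau>}" by auto
      qed (use \<tau>(1) r(3) in \<open>auto simp: S_def R_def\<close>)
      have one: "emeasure (N \<omega>) (R r) = 1"
        unfolding Nd emeasure_jump_measure[OF Rm] Sr by simp
      define s where "s = fst (W r \<omega>)"
      note W = single(1,2)[OF one rT(1), folded s_def]
      have s: "r < s" "s \<le> T" using W(1) by auto
      have "Z T \<omega> = \<phi> (T - s) (\<phi> (s - r) (Z r \<omega>) + h (jump (\<lambda>t. X t \<omega>) s))"
        by (rule jump_path_single_jump[OF jp fin rT(1) W(1)])
      also have "\<dots> = F r (Z r \<omega>) (W r \<omega>)"
        using s by (subst W(2)) (simp add: F_def \<phi>'_def)
      finally have "(Z r \<omega>, W r \<omega>) \<in> K r"
        using H by (simp add: K_def)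
      with elim(1) one r(1) rT show False by blast
    qed
  qed
  moreover have "{\<omega> \<in> space M. Z T \<omega> \<in> B \<and> 1 \<le> emeasure (N \<omega>) ({0..T} \<times> (-{0}))} \<in> events"
  proof -
    have "{0..T} \<times> (-{0::real}) \<in> sets borel" by (intro borel_Times) auto
    then have [measurable]: "(\<lambda>\<omega>. emeasure (N \<omega>) ({0..T} \<times> (-{0}))) \<in> borel_measurable M"
      by (intro poisson_random_measure_measurable[OF prm]) (simp add: sI)
    have [measurable]: "Z T \<in> borel_measurable M" using assms(1) by (intro Zm) simp
    show ?thesis by measurable
  qed
  ultimately show "{\<omega> \<in> space M. Z T \<omega> \<in> B \<and> 1 \<le> emeasure (N \<omega>) ({0..T} \<times> (-{0}))} \<in> null_sets M"
    by (subst AE_iff_null_sets) (auto elim: eventually_mono)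
qed

end
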